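(* Let $P$ be a positive integer, $N=2^L$ with $L$ a positive integer, $D_1,\ldots,D_{N^P},R$ positive integers, $\mathcal{A}\in\mathbb{R}^{D_1\times\cdots\times D_{N^P}}$ and $\epsilon>0$. Let $\mu:[N]^P\to[N^P]$ be compatible, and suppose that for all canonical partitions $(\mathcal{K},\mathcal{K}^c)\in\mathcal{C}^P_N$ it holds that $\mathrm{QE}(\mathcal{A};\mu(\mathcal{K}))\le\frac{\epsilon^2}{(2N^P-3)\|\mathcal{A}\|^2}\ln(R)$. Then there exists an assignment of the tensors of the $P$-dimensional locally connected tensor network of width $R$ generating $\mathcal{W}^P_{\mathrm{TN}}\in\mathbb{R}^{D_1\times\cdots\times D_{N^P}}$ with $\|\mathcal{W}^P_{\mathrm{TN}}-\mathcal{A}\|\le\epsilon$.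
   Context: Norms are Frobenius. For a tensor $\mathcal{A}\in\mathbb{R}^{D_1\times\cdots\times D_{N^P}}$ and $\mathcal{J}\subseteq[N^P]$, $[\![\mathcal{A};\mathcal{J}]\!]$ is its matrix arrangement with rows indexed by axes $\mathcal{J}$ and columns by the remaining axes; $\mathrm{QE}(\mathcal{A};\mathcal{J}):=-\sum_d\rho_d\ln\rho_d$ with $\rho_d=\sigma_d^2/\sum_{d'}\sigma_{d'}^2$ over the singular values of $[\![\mathcal{A};\mathcal{J}]\!]$ ($\mathrm{QE}(0;\mathcal{J})=0$). The $P$-dimensional locally connected tensor network of width $R$ has as graph a perfect $2^P$-ary tree of height $L$ with $N^P$ leaves, open edge of leaf $n$ of dimension $D_n$, inner edges of dimension $R$; it generates exactly the tensors: choose $\phi^{(0,n)}_r\in\mathbb{R}^{D_n}$ ($n\in[N^P]$, $r\in[R]$); for $l=1,\ldots,L-1$, $n\in[2^{P(L-l)}]$, $r\in[R]$ set $\phi^{(l,n)}_r=\sum_{i_1,\ldots,i_{2^P}\in[R]}a^{(l,n)}_{r,i_1,\ldots,i_{2^P}}\bigotimes_{k=1}^{2^P}\phi^{(l-1,2^P(n-1)+k)}_{i_k}$; and $\mathcal{W}^P_{\mathrm{TN}}=\sum_{i_1,\ldots,i_{2^P}}a_{i_1,\ldots,i_{2^P}}\bigotimes_{k=1}^{2^P}\phi^{(L-1,k)}_{i_k}$. A bijection $\mu:[N]^P\to[N^P]$ is compatible if for every node, the preimage under $\mu$ of the axis indices descending from it is a contiguous cubic block of $[N]^P$; $\mu(\mathcal{K}):=\{\mu(\mathbf{n}):\mathbf{n}\in\mathcal{K}\}$.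 The canonical partitions $\mathcal{C}^P_N$ of $[N]^P$ are the pairs $(\mathcal{K},[N]^P\setminus\mathcal{K})$ with $\mathcal{K}=\times_{p=1}^P\{2^{L-l}(n_p-1)+1,\ldots,2^{L-l}n_p\}$ for $l\in\{0,\ldots,L\}$, $n_1,\ldots,n_P\in[2^l]$. *)

theory Defs
  imports Complex_Main "HOL-Library.Multiset" "Jordan_Normal_Form.Char_Poly"
begin

text \<open>Conventions. A tensor of order M with mode dimensions D 1, ..., D M has axes 1..M;
  a tensor is a function from multi-indices (nat => nat) to reals, where the valid multi-indices
  are those i with i n < D n for n in 1..M (entries are 0-based within each mode).
  Only the values on valid multi-indices matter.\<close>

definition tidx :: "(nat \<Rightarrow> nat) \<Rightarrow> nat \<Rightarrow> (nat \<Rightarrow> nat) set" where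
  "tidx D M = PiE {1..M} (\<lambda>n. {..<D n})"

definition tnorm :: "(nat \<Rightarrow> nat) \<Rightarrow> nat \<Rightarrow> ((nat \<Rightarrow> nat) \<Rightarrow> real) \<Rightarrow> real" where
  "tnorm D M A = sqrt (\<Sum>i\<in>tidx D M. (A i)\<^sup>2)"

text \<open>Mixed-radix decoding of a row/column number k into the index of axis n in S.\<close>
definition dec :: "(nat \<Rightarrow> nat) \<Rightarrow> nat set \<Rightarrow> nat \<Rightarrow> nat \<Rightarrow> nat" where
  "dec D S k n = (k div (\<Prod>m\<in>{m\<in>S. m < n}. D m)) mod D n"

definition matricize :: "(nat \<Rightarrow> nat) \<Rightarrow> nat \<Rightarrow> ((nat \<Rightarrow> nat) \<Rightarrow> real) \<Rightarrow> nat set \<Rightarrow> real mat" where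
  "matricize D M A J = mat (\<Prod>n\<in>J. D n) (\<Prod>n\<in>{1..M} - J. D n)
     (\<lambda>(r, c). A (\<lambda>n. if n \<in> J then dec D J r n
                      else if n \<in> {1..M} then dec D ({1..M} - J) c n else undefined))"

definition singular_values :: "real mat \<Rightarrow> real multiset" where
  "singular_values X = image_mset sqrt (proots (char_poly
     (if dim_row X \<le> dim_col X then X * transpose_mat X else transpose_mat X * X)))"

definition QE :: "(nat \<Rightarrow> nat) \<Rightarrow> nat \<Rightarrow> ((nat \<Rightarrow> nat) \<Rightarrow> real) \<Rightarrow> nat set \<Rightarrow> real" where
  "QE D M A J =
     (let \<sigma>s = singular_values (matricize D M A J);
          tot = sum_mset (image_mset (\<lambda>s. s\<^sup>2) \<sigma>s)
      in if tot = 0 then 0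
         else - sum_mset (image_mset (\<lambda>s. (s\<^sup>2 / tot) * ln (s\<^sup>2 / tot)) \<sigma>s))"

definition grid :: "nat \<Rightarrow> nat \<Rightarrow> nat list set" where
  "grid P N = {xs. length xs = P \<and> (\<forall>p<P. 1 \<le> xs ! p \<and> xs ! p \<le> N)}"

definition cube :: "nat \<Rightarrow> (nat \<Rightarrow> nat) \<Rightarrow> nat \<Rightarrow> nat list set" where
  "cube P a s = {xs. length xs = P \<and> (\<forall>p<P. a p < xs ! p \<and> xs ! p \<le> a p + s)}"

text \<open>Node (l, n) of the tree (level l = 0 leaves, level L root, n in 1..2^(P(L-l)))
  has as descendant axes the leaves 2^(Pl)(n-1)+1 .. 2^(Pl) n.\<close>
definition compatible :: "nat \<Rightarrow> nat \<Rightarrow> (nat list \<Rightarrow> nat) \<Rightarrow> bool" where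
  "compatible P L \<mu> \<longleftrightarrow>
     bij_betw \<mu> (grid P (2^L)) {1..(2^L)^P} \<and>
     (\<forall>l\<le>L. \<forall>n\<in>{1..2^(P*(L-l))}. \<exists>a s.
        {x\<in>grid P (2^L). \<mu> x \<in> {2^(P*l)*(n-1)+1 .. 2^(P*l)*n}} = cube P a s)"

text \<open>The sets K of the canonical partitions (K, K^c) in C^P_N, N = 2^L.\<close>
definition canonical_blocks :: "nat \<Rightarrow> nat \<Rightarrow> nat list set set" where
  "canonical_blocks P L = {{xs. length xs = P \<and>
       (\<forall>p<P. 2^(L-l)*(n p - 1) + 1 \<le> xs ! p \<and> xs ! p \<le> 2^(L-l) * n p)} | l n.
       l \<le> L \<and> (\<forall>p<P. 1 \<le> n p \<and> n p \<le> 2^l)}"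

definition tuples :: "nat \<Rightarrow> nat \<Rightarrow> nat list set" where
  "tuples P R = {ks. length ks = 2^P \<and> set ks \<subseteq> {..<R}}"

text \<open>phi^(l,n)_r of the locally connected tensor network, as a tensor over all axes
  (depending only on its descendant axes). phi0 n r is the leaf vector in R^(D n),
  a l n r ks the core entries a^(l,n)_(r,i_1..i_2^P).\<close>
fun tn_phi :: "(nat \<Rightarrow> nat \<Rightarrow> nat \<Rightarrow> real) \<Rightarrow> (nat \<Rightarrow> nat \<Rightarrow> nat \<Rightarrow> nat list \<Rightarrow> real)
    \<Rightarrow> nat \<Rightarrow> nat \<Rightarrow> nat \<Rightarrow> nat \<Rightarrow> nat \<Rightarrow> (nat \<Rightarrow> nat) \<Rightarrow> real" where
  "tn_phi phi0 a P R 0 n r i = phi0 n r (i n)"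
| "tn_phi phi0 a P R (Suc l) n r i =
     (\<Sum>ks\<in>tuples P R. a (Suc l) n r ks *
        (\<Prod>k<2^P. tn_phi phi0 a P R l (2^P*(n-1) + k + 1) (ks ! k) i))"

definition tn_W :: "(nat \<Rightarrow> nat \<Rightarrow> nat \<Rightarrow> real) \<Rightarrow> (nat \<Rightarrow> nat \<Rightarrow> nat \<Rightarrow> nat list \<Rightarrow> real)
    \<Rightarrow> (nat list \<Rightarrow> real) \<Rightarrow> nat \<Rightarrow> nat \<Rightarrow> nat \<Rightarrow> (nat \<Rightarrow> nat) \<Rightarrow> real" where
  "tn_W phi0 a aroot P L R i =
     (\<Sum>ks\<in>tuples P R. aroot ks * (\<Prod>k<2^P. tn_phi phi0 a P R (L-1) (k + 1) (ks ! k) i))"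

end

theory Submission
  imports Defs "HOL-Analysis.Function_Topology"
begin

text \<open>
  For each tree node \<open>t\<close>, small entanglement entropy puts all but a fraction
  \<open>\<epsilon>\<^sup>2 / ((2N\<^sup>P - 3) \<parallel>A\<parallel>\<^sup>2)\<close> of the squared singular values of the matricization at \<open>t\<close> into at
  most \<open>R\<close> of them, so projecting the axes below \<open>t\<close> onto a span of \<open>R\<close> vectors \<open>U t\<close> moves \<open>A\<close> by a
  squared distance of at most \<open>\<delta> = \<epsilon>\<^sup>2 / (2N\<^sup>P - 3)\<close>.  Applying these projections from the root down to
  the leaves yields a network tensor whose cores are the inner products of \<open>U t\<close> with the products of
  the vectors of the children of \<open>t\<close>.  Since \<open>\<parallel>A - \<Pi> B\<parallel>\<^sup>2 \<le> \<parallel>A - \<Pi> A\<parallel>\<^sup>2 + \<parallel>A - B\<parallel>\<^sup>2\<close> for an orthogonal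
  projection \<open>\<Pi>\<close>, the squared errors add up, without any commutation of the projections.  For \<open>P \<ge> 2\<close>
  there are at most \<open>2N\<^sup>P - 3\<close> nodes below the root.  For \<open>P = 1\<close> there are \<open>2N - 2\<close>, but the two children
  of the root share one truncation: the vectors at the second child are taken as the normalised
  coefficients of \<open>A\<close> with respect to those at the first, and its projection then costs nothing.
\<close>

section \<open>Orthonormal eigenbases of real symmetric matrices\<close>

text \<open>Vectors are total functions of which only the values on \<open>X\<close> count. Tensors
  over different sets of axes can then share one type.\<close>

definition ip :: "'a set \<Rightarrow> ('a \<Rightarrow> real) \<Rightarrow> ('a \<Rightarrow> real) \<Rightarrow> real" where
  "ip X f g = (\<Sum>x\<in>X. f x * g x)"

lemma ip_commute: "ip X f g = ip X g f"
  by (simp add: ip_def mult.commute)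

lemma ip_add_left: "ip X (\<lambda>x. f x + g x) h = ip X f h + ip X g h"
  by (simp add: ip_def algebra_simps sum.distrib)

lemma ip_diff_left: "ip X (\<lambda>x. f x - g x) h = ip X f h - ip X g h"
  by (simp add: ip_def algebra_simps sum_subtractf)

lemma ip_scale_left: "ip X (\<lambda>x. c * f x) h = c * ip X f h"
  by (simp add: ip_def sum_distrib_left mult.assoc)

lemma ip_sum_left: "ip X (\<lambda>x. \<Sum>r\<in>T. f r x) h = (\<Sum>r\<in>T. ip X (f r) h)"
  unfolding ip_def sum_distrib_right by (rule sum.swap)

lemma ip_add_right: "ip X h (\<lambda>x. f x + g x) = ip X h f + ip X h g"
  by (metis ip_add_left ip_commute)

lemma ip_diff_right: "ip X h (\<lambda>x. f x - g x) = ip X h f - ip X h g"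
  by (metis ip_diff_left ip_commute)

lemma ip_scale_right: "ip X h (\<lambda>x. c * f x) = c * ip X h f"
  by (metis ip_scale_left ip_commute)

lemma ip_sum_right: "ip X h (\<lambda>x. \<Sum>r\<in>T. f r x) = (\<Sum>r\<in>T. ip X h (f r))"
  by (simp add: ip_commute[of X h] ip_sum_left)

lemmas ip_bilinear = ip_add_left ip_diff_left ip_scale_left ip_sum_left
  ip_add_right ip_diff_right ip_scale_right ip_sum_right

lemma ip_self_nonneg: "0 \<le> ip X f f"
  by (simp add: ip_def sum_nonneg)

lemma ip_self_eq_0: "finite X \<Longrightarrow> ip X f f = 0 \<longleftrightarrow> (\<forall>x\<in>X. f x = 0)"
  by (simp add: ip_def sum_nonneg_eq_0_iff)

lemma ip_cong: "(\<And>x. x \<in> X \<Longrightarrow> f x = f' x) \<Longrightarrow> (\<And>x. x \<in> X \<Longrightarrow> g x = g' x) \<Longrightarrow> ip X f g = ip X f' g'"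
  by (simp add: ip_def)

definition mulop :: "'b set \<Rightarrow> ('a \<Rightarrow> 'b \<Rightarrow> real) \<Rightarrow> ('b \<Rightarrow> real) \<Rightarrow> 'a \<Rightarrow> real" where
  "mulop Y g x i = ip Y (g i) x"

lemma mulop_add: "mulop Y g (\<lambda>i. x i + y i) = (\<lambda>i. mulop Y g x i + mulop Y g y i)"
  by (rule ext) (simp add: mulop_def ip_bilinear)

lemma mulop_scale: "mulop Y g (\<lambda>i. a * y i) = (\<lambda>i. a * mulop Y g y i)"
  by (rule ext) (simp add: mulop_def ip_bilinear)

lemma ip_mulop_symmetric:
  assumes "\<And>i j. i \<in> X \<Longrightarrow> j \<in> X \<Longrightarrow> g i j = g j i"
  shows "ip X a (mulop X g b) = ip X (mulop X g a) b"
proof -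
  have "ip X a (mulop X g b) = (\<Sum>i\<in>X. \<Sum>j\<in>X. a i * (g i j * b j))"
    by (simp add: ip_def mulop_def sum_distrib_left)
  also have "\<dots> = (\<Sum>j\<in>X. \<Sum>i\<in>X. a i * (g i j * b j))"
    by (rule sum.swap)
  also have "\<dots> = ip X (mulop X g a) b"
    unfolding ip_def mulop_def sum_distrib_right
    by (intro sum.cong refl) (simp add: assms)
  finally show ?thesis .
qed

section \<open>Existence of eigenvectors by maximising the quadratic form\<close>

lemma continuous_on_coordinate: "continuous_on C (\<lambda>x :: 'a \<Rightarrow> real. x i)"
  by (rule continuous_on_subset[OF continuous_on_product_coordinates subset_UNIV])

text \<open>As \<open>n\<close> is a variable, vectors live in the full function space. Pinning the
  coordinates from \<open>n\<close> on to zero makes the box a product of compact sets, so Tychonoff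
  applies.\<close>

lemma compact_box_function:
  "compact {x :: nat \<Rightarrow> real. (\<forall>i<n. \<bar>x i\<bar> \<le> 1) \<and> (\<forall>i\<ge>n. x i = 0)}"
proof -
  define B where "B i = (if i < n then {-1..1} else {0::real})" for i
  have "compactin (product_topology (\<lambda>_. euclidean) UNIV) (PiE UNIV B)"
    unfolding compactin_PiE by (auto simp: B_def)
  moreover have "PiE UNIV B = {x. (\<forall>i<n. \<bar>x i\<bar> \<le> 1) \<and> (\<forall>i\<ge>n. x i = 0)}"
    by (force simp: PiE_UNIV_domain Pi_iff B_def abs_le_iff split: if_splits)
  ultimately show ?thesis
    by (simp add: euclidean_product_topology)
qed

text \<open>A trace count replaces dimension theory: the components \<open>e i\<close> of the
  standard basis vectors orthogonal to all \<open>u r\<close> have squared norms adding up to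
  \<open>n - k > 0\<close>, so one of them can be normalised.\<close>

lemma exists_unit_orthogonal:
  fixes u :: "nat \<Rightarrow> nat \<Rightarrow> real"
  assumes k: "k < n"
    and orth: "\<And>r s. r < k \<Longrightarrow> s < k \<Longrightarrow> ip {..<n} (u r) (u s) = (if r = s then 1 else 0)"
  shows "\<exists>x. (\<forall>i\<ge>n. x i = 0) \<and> ip {..<n} x x = 1 \<and> (\<forall>r<k. ip {..<n} (u r) x = 0)"
proof -
  define e where "e i = (\<lambda>j. (if j = i then 1 else 0) - (\<Sum>r<k. u r i * u r j))" for i
  have delta: "ip {..<n} f (\<lambda>j. if j = i then 1 else 0) = f i" if "i < n" for f i
    using that by (simp add: ip_def if_distrib cong: if_cong)
  have ue: "ip {..<n} (u s) (e i) = 0" if "s < k" "i < n" for s i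
    using that unfolding e_def ip_bilinear by (simp add: delta orth if_distrib cong: if_cong)
  have ee: "ip {..<n} (e i) (e i) = 1 - (\<Sum>r<k. (u r i)\<^sup>2)" if "i < n" for i
  proof -
    have "ip {..<n} (e i) (e i) = ip {..<n} (e i) (\<lambda>j. if j = i then 1 else 0)"
      using that by (subst (2) e_def) (simp add: ip_bilinear ip_commute[of _ "e i" "u _"] ue)
    also have "\<dots> = 1 - (\<Sum>r<k. (u r i)\<^sup>2)"
      using that by (simp add: delta e_def power2_eq_square)
    finally show ?thesis .
  qed
  have "(\<Sum>i<n. ip {..<n} (e i) (e i)) = real n - (\<Sum>i<n. \<Sum>r<k. (u r i)\<^sup>2)"
    by (simp add: ee sum_subtractf)
  also have "(\<Sum>i<n. \<Sum>r<k. (u r i)\<^sup>2) = (\<Sum>r<k. ip {..<n} (u r) (u r))"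
    by (subst sum.swap) (simp add: ip_def power2_eq_square)
  also have "\<dots> = real k"
    by (simp add: orth)
  finally have "(\<Sum>i<n. ip {..<n} (e i) (e i)) \<noteq> 0"
    using k by simp
  then obtain i where i: "i < n" "ip {..<n} (e i) (e i) \<noteq> 0"
    by (meson lessThan_iff sum.neutral)
  define c where "c = ip {..<n} (e i) (e i)"
  have c: "c > 0"
    using i ip_self_nonneg[of "{..<n}" "e i"] by (simp add: c_def)
  let ?x = "\<lambda>j. if j < n then (1 / sqrt c) * e i j else 0"
  have x: "ip {..<n} f ?x = (1 / sqrt c) * ip {..<n} f (e i)" for f
    unfolding ip_scale_right[symmetric] by (rule ip_cong) auto
  have "ip {..<n} ?x ?x = (1 / sqrt c) * ((1 / sqrt c) * c)"
    by (subst x, subst ip_commute, subst x) (simp add: c_def)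
  then have "ip {..<n} ?x ?x = 1"
    using c by (simp add: field_simps)
  moreover have "\<forall>r<k. ip {..<n} (u r) ?x = 0"
    using i by (simp add: x ue)
  ultimately show ?thesis
    by (intro exI[of _ ?x]) auto
qed

text \<open>The eigenvector is a maximiser of the quadratic form on the unit sphere of the orthogonal
  complement of the eigenvectors found so far; \<open>h\<close> is its defect of being one.\<close>

lemma exists_next_eigenvector:
  fixes u :: "nat \<Rightarrow> nat \<Rightarrow> real"
  assumes k: "k < n"
    and orth: "\<And>r s. r < k \<Longrightarrow> s < k \<Longrightarrow> ip {..<n} (u r) (u s) = (if r = s then 1 else 0)"
    and sym: "\<And>i j. i < n \<Longrightarrow> j < n \<Longrightarrow> g i j = g j i"
    and eig: "\<And>r i. r < k \<Longrightarrow> i < n \<Longrightarrow> mulop {..<n} g (u r) i = c r * u r i"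
  shows "\<exists>x d. ip {..<n} x x = 1 \<and> (\<forall>r<k. ip {..<n} (u r) x = 0) \<and>
           (\<forall>i<n. mulop {..<n} g x i = d * x i)"
proof -
  define C where "C = {x :: nat \<Rightarrow> real. (\<forall>i\<ge>n. x i = 0) \<and> ip {..<n} x x = 1
      \<and> (\<forall>r<k. ip {..<n} (u r) x = 0)}"
  define q where "q x = ip {..<n} x (mulop {..<n} g x)" for x
  have C_sub: "\<bar>x i\<bar> \<le> 1" if "x \<in> C" "i < n" for x i
  proof -
    have "(x i)\<^sup>2 \<le> (\<Sum>i<n. (x i)\<^sup>2)"
      using that by (intro member_le_sum) auto
    also have "\<dots> = 1"
      using that by (simp add: C_def ip_def power2_eq_square)
    finally show ?thesis
      by (simp add: abs_square_le_1)
  qed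
  have C_eq: "C = {x. (\<forall>i<n. \<bar>x i\<bar> \<le> 1) \<and> (\<forall>i\<ge>n. x i = 0)} \<inter>
     ({x. ip {..<n} x x = 1} \<inter> (\<Inter>r\<in>{..<k}. {x. ip {..<n} (u r) x = 0}))"
    using C_sub by (auto simp: C_def)
  have "closed {x :: nat \<Rightarrow> real. ip {..<n} x x = 1}"
    unfolding ip_def by (intro closed_Collect_eq continuous_intros continuous_on_coordinate)
  moreover have "closed {x :: nat \<Rightarrow> real. ip {..<n} (u r) x = 0}" for r
    unfolding ip_def by (intro closed_Collect_eq continuous_intros continuous_on_coordinate)
  ultimately have "compact C"
    unfolding C_eq by (intro compact_Int_closed compact_box_function closed_Int closed_INT) auto
  moreover have "C \<noteq> {}"
    using exists_unit_orthogonal[OF k orth] by (auto simp: C_def)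
  moreover have "continuous_on C q"
    unfolding q_def ip_def mulop_def by (intro continuous_intros continuous_on_coordinate)
  ultimately obtain x where x: "x \<in> C" and max: "\<And>y. y \<in> C \<Longrightarrow> q y \<le> q x"
    using continuous_attains_sup by metis
  have xx: "ip {..<n} x x = 1" and ux: "\<And>r. r < k \<Longrightarrow> ip {..<n} (u r) x = 0"
    using x by (auto simp: C_def)
  have q_scale: "q (\<lambda>i. a * y i) = a\<^sup>2 * q y" for a y
    by (simp add: q_def mulop_scale ip_bilinear power2_eq_square)
  have q_cong: "q y = q y'" if "\<And>i. i < n \<Longrightarrow> y i = y' i" for y y'
    unfolding q_def mulop_def using that by (auto intro!: ip_cong)
  \<comment> \<open>Homogeneity extends the maximum over unit vectors to a Rayleigh bound on the
    whole orthogonal complement.\<close>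
  have bound: "q z \<le> q x * ip {..<n} z z" if z: "\<And>r. r < k \<Longrightarrow> ip {..<n} (u r) z = 0" for z
  proof (cases "ip {..<n} z z = 0")
    case True
    then have "q z = q (\<lambda>_. 0)"
      by (intro q_cong) (simp add: ip_self_eq_0)
    then show ?thesis
      using True by (simp add: q_def ip_def)
  next
    case False
    define a where "a = ip {..<n} z z"
    have a: "a > 0"
      using False ip_self_nonneg[of "{..<n}" z] by (simp add: a_def)
    let ?y = "\<lambda>j. if j < n then (1 / sqrt a) * z j else 0"
    have y: "ip {..<n} f ?y = (1 / sqrt a) * ip {..<n} f z" for f
      unfolding ip_scale_right[symmetric] by (rule ip_cong) auto
    have "ip {..<n} ?y ?y = (1 / sqrt a) * ((1 / sqrt a) * a)"
      by (subst y, subst ip_commute, subst y) (simp add: a_def)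
    then have "?y \<in> C"
      using a z by (simp add: C_def y field_simps)
    then have "q ?y \<le> q x"
      by (rule max)
    moreover have "q ?y = (1 / sqrt a)\<^sup>2 * q z"
      unfolding q_scale[symmetric] by (rule q_cong) simp
    ultimately show ?thesis
      using a by (simp add: a_def[symmetric] power_divide field_simps)
  qed
  define h where "h i = mulop {..<n} g x i - q x * x i" for i
  have Gx: "mulop {..<n} g x = (\<lambda>i. h i + q x * x i)"
    by (simp add: h_def)
  \<comment> \<open>The complement of eigenvectors is invariant under a symmetric operator, so
    \<open>x + t * h\<close> stays in it and may be compared with the maximiser.\<close>
  have uh: "ip {..<n} (u r) h = 0" if "r < k" for r
  proof -
    have "ip {..<n} (u r) (mulop {..<n} g x) = ip {..<n} (mulop {..<n} g (u r)) x"
      using sym by (intro ip_mulop_symmetric) auto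
    also have "\<dots> = ip {..<n} (\<lambda>i. c r * u r i) x"
      using that by (intro ip_cong) (auto simp: eig)
    also have "\<dots> = 0"
      using that by (simp add: ip_bilinear ux)
    finally show ?thesis
      using that ux[OF that] by (simp add: Gx ip_bilinear)
  qed
  have "q x = ip {..<n} x h + q x"
    by (subst q_def) (simp add: Gx ip_bilinear xx)
  then have xh: "ip {..<n} x h = 0"
    by simp
  have hGx: "ip {..<n} h (mulop {..<n} g x) = ip {..<n} h h"
    by (simp add: Gx ip_bilinear ip_commute[of _ h x] xh)
  have xGh: "ip {..<n} x (mulop {..<n} g h) = ip {..<n} h h"
  proof -
    have "ip {..<n} x (mulop {..<n} g h) = ip {..<n} (mulop {..<n} g x) h"
      using sym by (intro ip_mulop_symmetric) auto
    then show ?thesis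
      by (metis hGx ip_commute)
  qed
  \<comment> \<open>Zeroth-order terms of \<open>bound\<close> at \<open>x + t * h\<close> cancel.
    After division by \<open>t\<close>, the left side is the first-order growth of \<open>q\<close>
    along \<open>h\<close>, and the right side collects the second-order terms.\<close>
  have perturb: "2 * ip {..<n} h h \<le> t * (q x * ip {..<n} h h - q h)" if "t > 0" for t
  proof -
    have "q (\<lambda>i. x i + t * h i) \<le> q x * ip {..<n} (\<lambda>i. x i + t * h i) (\<lambda>i. x i + t * h i)"
      by (rule bound) (simp add: ip_bilinear ux uh)
    moreover have "q (\<lambda>i. x i + t * h i) = q x + 2 * t * ip {..<n} h h + t\<^sup>2 * q h"
      by (simp add: q_def[of "\<lambda>i. x i + t * h i"] mulop_add mulop_scale ip_bilinear hGx xGh)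
        (simp add: q_def power2_eq_square algebra_simps)
    moreover have "ip {..<n} (\<lambda>i. x i + t * h i) (\<lambda>i. x i + t * h i) = 1 + t\<^sup>2 * ip {..<n} h h"
      by (simp add: ip_bilinear xx xh ip_commute[of _ h x] power2_eq_square algebra_simps)
    ultimately have "t * (2 * ip {..<n} h h) \<le> t * (t * (q x * ip {..<n} h h - q h))"
      by (simp add: power2_eq_square algebra_simps)
    then show ?thesis
      using that by simp
  qed
  have "ip {..<n} h h = 0"
  proof (rule ccontr)
    assume "ip {..<n} h h \<noteq> 0"
    then have H: "ip {..<n} h h > 0"
      using ip_self_nonneg[of "{..<n}" h] by simp
    define b where "b = q x * ip {..<n} h h - q h"
    have "2 * ip {..<n} h h \<le> b"
      using perturb[of 1] by (simp add: b_def)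
    then have b: "b > 0"
      using H by linarith
    \<comment> \<open>For this \<open>t\<close> the right side of \<open>perturb\<close> is the
      squared norm of \<open>h\<close>, only half of the left side. The choice \<open>t = 1\<close>
      above ensured \<open>b > 0\<close>.\<close>
    have "2 * ip {..<n} h h \<le> (ip {..<n} h h / b) * b"
      unfolding b_def using H b by (intro perturb) (simp add: b_def)
    then show False
      using H b by simp
  qed
  then have "\<forall>i<n. h i = 0"
    by (simp add: ip_self_eq_0)
  then have "\<forall>i<n. mulop {..<n} g x i = q x * x i"
    by (simp add: h_def)
  then show ?thesis
    using xx ux by blast
qed

lemma orthonormal_eigenbasis:
  fixes n :: nat
  assumes sym: "\<And>i j. i < n \<Longrightarrow> j < n \<Longrightarrow> g i j = g j i"
  shows "\<exists>u c. (\<forall>r<n. \<forall>s<n. ip {..<n} (u r) (u s) = (if r = s then 1 else 0)) \<and>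
           (\<forall>r<n. \<forall>i<n. mulop {..<n} g (u r) i = c r * u r i)"
proof -
  have "\<exists>u c. (\<forall>r<k. \<forall>s<k. ip {..<n} (u r) (u s) = (if r = s then 1 else 0)) \<and>
           (\<forall>r<k. \<forall>i<n. mulop {..<n} g (u r) i = c r * u r i)" if "k \<le> n" for k
    using that
  proof (induction k)
    case 0
    then show ?case by simp
  next
    case (Suc k)
    then have "k \<le> n" and k: "k < n" by auto
    from Suc.IH[OF this(1)] obtain u c
      where u: "\<And>r s. r < k \<Longrightarrow> s < k \<Longrightarrow> ip {..<n} (u r) (u s) = (if r = s then 1 else 0)"
        and c: "\<And>r i. r < k \<Longrightarrow> i < n \<Longrightarrow> mulop {..<n} g (u r) i = c r * u r i"
      by blast
    obtain x d where x: "ip {..<n} x x = 1" "\<And>r. r < k \<Longrightarrow> ip {..<n} (u r) x = 0"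
      "\<And>i. i < n \<Longrightarrow> mulop {..<n} g x i = d * x i"
      using exists_next_eigenvector[OF k u sym c] by blast
    define u' where "u' = u(k := x)"
    define c' where "c' = c(k := d)"
    have "ip {..<n} (u' r) (u' s) = (if r = s then 1 else 0)" if "r < Suc k" "s < Suc k" for r s
    proof (cases "r = k")
      case True
      then show ?thesis
        using that x(1) x(2)[of s] by (cases "s = k") (simp_all add: u'_def ip_commute[of _ x "u s"])
    next
      case False
      then show ?thesis
        using that u[of r s] x(2)[of r] by (cases "s = k") (simp_all add: u'_def)
    qed
    moreover have "mulop {..<n} g (u' r) i = c' r * u' r i" if "r < Suc k" "i < n" for r i
      using that x(3)[of i] c[of r i] by (cases "r = k") (simp_all add: u'_def c'_def)
    ultimately show ?case
      by (intro exI[of _ u'] exI[of _ c']) simp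
  qed
  then show ?thesis by blast
qed

text \<open>The eigenbasis makes \<open>G\<close> similar to a diagonal matrix, so the
  characteristic polynomial splits with the eigenvalues as roots, multiplicities included. The
  completeness relation is \<open>U * V = 1\<close>, which for square matrices follows from
  orthonormality, \<open>V * U = 1\<close>.\<close>

lemma symmetric_matrix_spectral:
  fixes G :: "real mat"
  assumes G: "G \<in> carrier_mat n n" and sym: "\<And>i j. i < n \<Longrightarrow> j < n \<Longrightarrow> G $$ (i,j) = G $$ (j,i)"
  shows "\<exists>u c. (\<forall>r<n. \<forall>s<n. ip {..<n} (u r) (u s) = of_bool (r = s)) \<and>
    (\<forall>i<n. \<forall>j<n. (\<Sum>r<n. u r i * u r j) = of_bool (i = j)) \<and>
    (\<forall>r<n. \<forall>i<n. (\<Sum>j<n. G $$ (i,j) * u r j) = c r * u r i) \<and>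
    proots (char_poly G) = image_mset c (mset_set {..<n})"
proof -
  obtain u c where uc: "\<forall>r<n. \<forall>s<n. ip {..<n} (u r) (u s) = (if r = s then 1 else 0)"
    "\<forall>r<n. \<forall>i<n. mulop {..<n} (\<lambda>i j. G $$ (i,j)) (u r) i = c r * u r i"
    using orthonormal_eigenbasis[of n "\<lambda>i j. G $$ (i,j)", OF sym] by metis
  have u: "\<And>r s. r < n \<Longrightarrow> s < n \<Longrightarrow> ip {..<n} (u r) (u s) = (if r = s then 1 else 0)"
    and c: "\<And>r i. r < n \<Longrightarrow> i < n \<Longrightarrow> mulop {..<n} (\<lambda>i j. G $$ (i,j)) (u r) i = c r * u r i"
    using uc by auto
  have c': "\<And>r i. r < n \<Longrightarrow> i < n \<Longrightarrow> (\<Sum>j<n. G $$ (i,j) * u r j) = c r * u r i"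
    using c by (simp add: mulop_def ip_def)
  define U where "U = mat n n (\<lambda>(i,r). u r i)"
  define V where "V = mat n n (\<lambda>(r,i). u r i)"
  define E where "E = mat n n (\<lambda>(i,j). if i = j then c i else 0)"
  have carr: "U \<in> carrier_mat n n" "V \<in> carrier_mat n n" "E \<in> carrier_mat n n"
    by (auto simp: U_def V_def E_def)
  have VU: "V * U = 1\<^sub>m n"
    using u by (intro eq_matI) (auto simp: U_def V_def scalar_prod_def ip_def lessThan_atLeast0)
  then have UV: "U * V = 1\<^sub>m n"
    using mat_mult_left_right_inverse[OF carr(2,1)] by simp
  have "G * U = U * E"
    using G carr c'
    by (intro eq_matI)
      (auto simp: U_def E_def scalar_prod_def lessThan_atLeast0 if_distrib cong: if_cong)
  then have "G = U * E * V"
    using G carr UV by (metis assoc_mult_mat right_mult_one_mat)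
  then have "similar_mat G E"
    using G carr UV VU by (intro similar_matI[of _ _ U V n]) auto
  then have "char_poly G = char_poly E"
    by (rule char_poly_similar)
  also have "\<dots> = (\<Prod>a\<leftarrow>diag_mat E. [:- a, 1:])"
    using carr by (intro char_poly_upper_triangular[of _ n]) (auto simp: E_def upper_triangular_def)
  also have "diag_mat E = map c [0..<n]"
    by (auto simp: diag_mat_def E_def)
  finally have "proots (char_poly G) = (\<Sum>r\<leftarrow>[0..<n]. {#c r#})"
    using proots_prod_list[of "map (\<lambda>r. [:- c r, 1:]) [0..<n]"]
    by (simp add: o_def image_iff eq_commute[of 0])
  also have "(\<Sum>r\<leftarrow>[0..<n]. {#c r#}) = image_mset c (mset_set {..<n})" for n
    by (induction n) (auto simp: lessThan_Suc)
  finally have "proots (char_poly G) = image_mset c (mset_set {..<n})" .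
  moreover have "(\<Sum>r<n. u r i * u r j) = of_bool (i = j)" if "i < n" "j < n" for i j
  proof -
    have "(U * V) $$ (i,j) = (\<Sum>r<n. u r i * u r j)"
      using that by (simp add: U_def V_def scalar_prod_def lessThan_atLeast0)
    then show ?thesis
      using UV that by (cases "i = j") simp_all
  qed
  ultimately show ?thesis
    using u c' by (intro exI[of _ u] exI[of _ c]) simp
qed

section \<open>Singular values and entropy\<close>

text \<open>Zero vectors are allowed, so that a family can be padded to exactly \<open>R\<close> members.\<close>

definition suborthonormal :: "'a set \<Rightarrow> 'r set \<Rightarrow> ('r \<Rightarrow> 'a \<Rightarrow> real) \<Rightarrow> bool" where
  "suborthonormal X T u \<longleftrightarrow> (\<forall>r\<in>T. \<forall>s\<in>T. r \<noteq> s \<longrightarrow> ip X (u r) (u s) = 0) \<and>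
     (\<forall>r\<in>T. ip X (u r) (u r) = 0 \<or> ip X (u r) (u r) = 1)"

text \<open>The images of the eigenvectors under the transpose of \<open>X\<close> are orthogonal
  because their inner products are those of \<open>u r\<close> with \<open>G\<close> applied to
  \<open>u s\<close>; the eigenvalue sum is the trace of \<open>G\<close>. An entry function in
  place of a matrix lets the lemma serve both Gram matrices, that of the rows and that of the
  columns.\<close>

lemma gram_spectral:
  fixes X :: "nat \<Rightarrow> nat \<Rightarrow> real"
  assumes G: "G \<in> carrier_mat m m"
    and GX: "\<And>i j. i < m \<Longrightarrow> j < m \<Longrightarrow> G $$ (i,j) = (\<Sum>y<n. X i y * X j y)"
  shows "\<exists>u c. proots (char_poly G) = image_mset c (mset_set {..<m}) \<and>
    (\<forall>r<m. \<forall>s<m. ip {..<m} (u r) (u s) = of_bool (r = s)) \<and>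
    (\<forall>r<m. \<forall>i<m. (\<Sum>j<m. G $$ (i,j) * u r j) = c r * u r i) \<and>
    (\<forall>r<m. \<forall>s<m. ip {..<n} (\<lambda>y. ip {..<m} (u r) (\<lambda>x. X x y)) (\<lambda>y. ip {..<m} (u s) (\<lambda>x. X x y))
        = of_bool (r = s) * c s) \<and>
    (\<Sum>r<m. c r) = (\<Sum>x<m. \<Sum>y<n. (X x y)\<^sup>2)"
proof -
  have sym: "\<And>i j. i < m \<Longrightarrow> j < m \<Longrightarrow> G $$ (i,j) = G $$ (j,i)"
    by (simp add: GX mult.commute)
  obtain u c where uc: "\<forall>r<m. \<forall>s<m. ip {..<m} (u r) (u s) = of_bool (r = s)"
    "\<forall>i<m. \<forall>j<m. (\<Sum>r<m. u r i * u r j) = of_bool (i = j)"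
    "\<forall>r<m. \<forall>i<m. (\<Sum>j<m. G $$ (i,j) * u r j) = c r * u r i"
    and roots: "proots (char_poly G) = image_mset c (mset_set {..<m})"
    using symmetric_matrix_spectral[OF G sym] by blast
  have u: "ip {..<m} (u r) (u s) = of_bool (r = s)" if "r < m" "s < m" for r s
    using uc(1) that by simp
  have uu: "(\<Sum>r<m. u r i * u r j) = of_bool (i = j)" if "i < m" "j < m" for i j
    using uc(2) that by simp
  have c: "(\<Sum>j<m. G $$ (i,j) * u r j) = c r * u r i" if "r < m" "i < m" for r i
    using uc(3) that by simp
  define w where "w r y = ip {..<m} (u r) (\<lambda>x. X x y)" for r y
  have w: "ip {..<n} (w r) (w s) = of_bool (r = s) * c s" if "r < m" "s < m" for r s
  proof -
    have "ip {..<n} (w r) (w s) = (\<Sum>y<n. \<Sum>i<m. \<Sum>j<m. (u r i * X i y) * (u s j * X j y))"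
      by (simp add: ip_def w_def sum_product)
    also have "\<dots> = (\<Sum>i<m. \<Sum>j<m. \<Sum>y<n. (u r i * X i y) * (u s j * X j y))"
      by (subst sum.swap) (intro sum.cong refl sum.swap)
    also have "\<dots> = (\<Sum>i<m. \<Sum>j<m. u r i * (G $$ (i,j) * u s j))"
      by (intro sum.cong refl) (simp add: GX sum_distrib_left sum_distrib_right mult_ac)
    also have "\<dots> = (\<Sum>i<m. u r i * (c s * u s i))"
      using that by (simp add: sum_distrib_left[symmetric] c)
    also have "\<dots> = c s * ip {..<m} (u r) (u s)"
      by (simp add: ip_def sum_distrib_left mult_ac)
    finally show ?thesis
      using that by (simp add: u)
  qed
  have "(\<Sum>r<m. c r) = (\<Sum>r<m. ip {..<n} (w r) (w r))"
    by (simp add: w)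
  also have "\<dots> = (\<Sum>r<m. \<Sum>y<n. \<Sum>i<m. \<Sum>j<m. (u r i * X i y) * (u r j * X j y))"
    by (simp add: ip_def w_def sum_product)
  also have "\<dots> = (\<Sum>y<n. \<Sum>r<m. \<Sum>i<m. \<Sum>j<m. (u r i * X i y) * (u r j * X j y))"
    by (rule sum.swap)
  also have "\<dots> = (\<Sum>y<n. \<Sum>i<m. \<Sum>j<m. \<Sum>r<m. (u r i * X i y) * (u r j * X j y))"
  proof (rule sum.cong[OF refl])
    fix y
    have "(\<Sum>r<m. \<Sum>i<m. \<Sum>j<m. (u r i * X i y) * (u r j * X j y))
        = (\<Sum>i<m. \<Sum>r<m. \<Sum>j<m. (u r i * X i y) * (u r j * X j y))"
      by (rule sum.swap)
    also have "\<dots> = (\<Sum>i<m. \<Sum>j<m. \<Sum>r<m. (u r i * X i y) * (u r j * X j y))"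
      by (rule sum.cong[OF refl]) (rule sum.swap)
    finally show "(\<Sum>r<m. \<Sum>i<m. \<Sum>j<m. (u r i * X i y) * (u r j * X j y))
        = (\<Sum>i<m. \<Sum>j<m. \<Sum>r<m. (u r i * X i y) * (u r j * X j y))" .
  qed
  also have "\<dots> = (\<Sum>y<n. \<Sum>i<m. \<Sum>j<m. X i y * X j y * (\<Sum>r<m. u r i * u r j))"
    by (simp add: sum_distrib_left mult_ac)
  also have "\<dots> = (\<Sum>y<n. \<Sum>i<m. (X i y)\<^sup>2)"
    by (simp add: uu if_distrib power2_eq_square cong: if_cong)
  also have "\<dots> = (\<Sum>x<m. \<Sum>y<n. (X x y)\<^sup>2)"
    by (rule sum.swap)
  finally have tot: "(\<Sum>r<m. c r) = (\<Sum>x<m. \<Sum>y<n. (X x y)\<^sup>2)" .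
  have w': "\<forall>r<m. \<forall>s<m. ip {..<n} (\<lambda>y. ip {..<m} (u r) (\<lambda>x. X x y)) (\<lambda>y. ip {..<m} (u s) (\<lambda>x. X x y))
        = of_bool (r = s) * c s"
    using w unfolding w_def by blast
  show ?thesis
    by (rule exI[of _ u], rule exI[of _ c]) (intro conjI roots uc(1,3) w' tot)
qed

text \<open>\<open>singular_values\<close> uses the smaller Gram matrix. For
  \<open>m \<le> n\<close> its eigenvectors are the left singular vectors; otherwise they are the
  right ones, and the left ones are their normalised images under \<open>X\<close>.\<close>

lemma thin_svd:
  assumes X: "X \<in> carrier_mat m n"
  shows "\<exists>(k::nat) u c. singular_values X = image_mset (\<lambda>r. sqrt (c r)) (mset_set {..<k}) \<and>
    suborthonormal {..<m} {..<k} u \<and>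
    (\<forall>r<k. \<forall>s<k. ip {..<n} (\<lambda>y. ip {..<m} (u r) (\<lambda>x. X $$ (x,y))) (\<lambda>y. ip {..<m} (u s) (\<lambda>x. X $$ (x,y)))
        = of_bool (r = s) * c s) \<and>
    (\<Sum>r<k. c r) = (\<Sum>x<m. \<Sum>y<n. (X $$ (x,y))\<^sup>2)"
proof (cases "m \<le> n")
  case True
  have G: "X * transpose_mat X \<in> carrier_mat m m"
    using X by auto
  have GX: "(X * transpose_mat X) $$ (i,j) = (\<Sum>y<n. X $$ (i,y) * X $$ (j,y))" if "i < m" "j < m" for i j
    using X that by (simp add: scalar_prod_def lessThan_atLeast0)
  obtain u c where uc: "proots (char_poly (X * transpose_mat X)) = image_mset c (mset_set {..<m})"
    "\<forall>r<m. \<forall>s<m. ip {..<m} (u r) (u s) = of_bool (r = s)"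
    "\<forall>r<m. \<forall>s<m. ip {..<n} (\<lambda>y. ip {..<m} (u r) (\<lambda>x. X $$ (x,y))) (\<lambda>y. ip {..<m} (u s) (\<lambda>x. X $$ (x,y)))
        = of_bool (r = s) * c s"
    "(\<Sum>r<m. c r) = (\<Sum>x<m. \<Sum>y<n. (X $$ (x,y))\<^sup>2)"
    using gram_spectral[OF G GX] by blast
  have sv: "singular_values X = image_mset (\<lambda>r. sqrt (c r)) (mset_set {..<m})"
    using X True by (simp add: singular_values_def uc(1) multiset.map_comp o_def)
  have so: "suborthonormal {..<m} {..<m} u"
    using uc(2) by (simp add: suborthonormal_def)
  show ?thesis
    using sv so uc(3,4) by blast
next
  case False
  have G: "transpose_mat X * X \<in> carrier_mat n n"
    using X by auto
  have GX: "(transpose_mat X * X) $$ (i,j) = (\<Sum>y<m. X $$ (y,i) * X $$ (y,j))" if "i < n" "j < n" for i j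
    using X that by (simp add: scalar_prod_def lessThan_atLeast0)
  obtain v c where vc: "proots (char_poly (transpose_mat X * X)) = image_mset c (mset_set {..<n})"
    "\<forall>r<n. \<forall>s<n. ip {..<n} (v r) (v s) = of_bool (r = s)"
    "\<forall>r<n. \<forall>i<n. (\<Sum>j<n. (transpose_mat X * X) $$ (i,j) * v r j) = c r * v r i"
    "\<forall>r<n. \<forall>s<n. ip {..<m} (\<lambda>y. ip {..<n} (v r) (\<lambda>x. X $$ (y,x))) (\<lambda>y. ip {..<n} (v s) (\<lambda>x. X $$ (y,x)))
        = of_bool (r = s) * c s"
    "(\<Sum>r<n. c r) = (\<Sum>x<n. \<Sum>y<m. (X $$ (y,x))\<^sup>2)"
    using gram_spectral[OF G GX] by blast
  have c0: "c r \<ge> 0" if "r < n" for r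
  proof -
    have "c r = ip {..<m} (\<lambda>y. ip {..<n} (v r) (\<lambda>x. X $$ (y,x))) (\<lambda>y. ip {..<n} (v r) (\<lambda>x. X $$ (y,x)))"
      using vc(4) that by simp
    then show ?thesis
      by (simp add: ip_self_nonneg)
  qed
  \<comment> \<open>For \<open>c r = 0\<close> the division by zero makes \<open>u r\<close> the
    zero vector, which \<open>suborthonormal\<close> admits.\<close>
  define u where "u r x = (1 / sqrt (c r)) * ip {..<n} (v r) (\<lambda>y. X $$ (x,y))" for r x
  have uu: "ip {..<m} (u r) (u s) = (1 / sqrt (c r)) * ((1 / sqrt (c s)) * (of_bool (r = s) * c s))"
    if "r < n" "s < n" for r s
  proof -
    have "ip {..<m} (\<lambda>y. ip {..<n} (v r) (\<lambda>x. X $$ (y,x))) (\<lambda>y. ip {..<n} (v s) (\<lambda>x. X $$ (y,x)))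
        = of_bool (r = s) * c s"
      using vc(4) that by simp
    then show ?thesis
      unfolding u_def ip_scale_left ip_scale_right by simp
  qed
  have so: "suborthonormal {..<m} {..<n} u"
    using c0 by (simp add: suborthonormal_def uu)
  have w: "ip {..<m} (u r) (\<lambda>x. X $$ (x,y)) = sqrt (c r) * v r y" if "r < n" "y < n" for r y
  proof -
    have "ip {..<m} (u r) (\<lambda>x. X $$ (x,y)) =
        (1 / sqrt (c r)) * (\<Sum>x<m. \<Sum>y'<n. v r y' * X $$ (x,y') * X $$ (x,y))"
      by (simp add: u_def[abs_def] ip_def sum_distrib_right sum_divide_distrib)
    also have "(\<Sum>x<m. \<Sum>y'<n. v r y' * X $$ (x,y') * X $$ (x,y)) =
        (\<Sum>y'<n. (transpose_mat X * X) $$ (y,y') * v r y')"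
      using that by (subst sum.swap, intro sum.cong refl)
        (simp add: GX sum_distrib_left sum_distrib_right mult_ac del: index_mult_mat)
    also have "\<dots> = c r * v r y"
      using vc(3) that by blast
    also have "(1 / sqrt (c r)) * (c r * v r y) = (c r / sqrt (c r)) * v r y"
      by simp
    finally show ?thesis
      unfolding real_div_sqrt[OF c0[OF that(1)]] .
  qed
  have ww: "ip {..<n} (\<lambda>y. ip {..<m} (u r) (\<lambda>x. X $$ (x,y))) (\<lambda>y. ip {..<m} (u s) (\<lambda>x. X $$ (x,y)))
        = of_bool (r = s) * c s" if "r < n" "s < n" for r s
  proof -
    have "ip {..<n} (\<lambda>y. ip {..<m} (u r) (\<lambda>x. X $$ (x,y))) (\<lambda>y. ip {..<m} (u s) (\<lambda>x. X $$ (x,y)))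
        = ip {..<n} (\<lambda>y. sqrt (c r) * v r y) (\<lambda>y. sqrt (c s) * v s y)"
      using that by (intro ip_cong) (simp_all add: w)
    also have "\<dots> = sqrt (c r) * (sqrt (c s) * of_bool (r = s))"
      using that vc(2) by (simp add: ip_scale_left ip_scale_right)
    finally show ?thesis
      using c0[OF that(1)] by (cases "r = s") simp_all
  qed
  have sv: "singular_values X = image_mset (\<lambda>r. sqrt (c r)) (mset_set {..<n})"
    using X False by (simp add: singular_values_def vc(1) multiset.map_comp o_def)
  have tot: "(\<Sum>r<n. c r) = (\<Sum>x<m. \<Sum>y<n. (X $$ (x,y))\<^sup>2)"
    unfolding vc(5) by (rule sum.swap)
  show ?thesis
    using sv so ww tot by blast
qed

text \<open>The set \<open>T\<close> consists of the indices of probability at least \<open>1 / R\<close>.  Outside \<open>T\<close> each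
  \<open>- ln p\<close> exceeds \<open>ln R\<close>; the case \<open>R = 1\<close>, where \<open>ln R = 0\<close>, is treated separately.\<close>

lemma entropy_tail:
  fixes c :: "'a \<Rightarrow> real"
  assumes K: "finite K" and c0: "\<And>r. r \<in> K \<Longrightarrow> c r \<ge> 0" and tot: "sum c K > 0"
    and R: "R > 0" and b: "b \<ge> 0"
    and H: "- (\<Sum>r\<in>K. (c r / sum c K) * ln (c r / sum c K)) \<le> b * ln (real R)"
  shows "\<exists>T\<subseteq>K. card T \<le> R \<and> sum c (K - T) \<le> b * sum c K"
proof -
  define p where "p r = c r / sum c K" for r
  define T where "T = {r\<in>K. p r \<ge> 1 / real R}"
  have T: "T \<subseteq> K" "finite T"
    using K by (auto simp: T_def)
  have p0: "p r \<ge> 0" if "r \<in> K" for r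
    using c0[OF that] tot by (simp add: p_def)
  have p_sum: "sum p K = 1"
    using tot by (simp add: p_def sum_divide_distrib[symmetric])
  have p1: "p r \<le> 1" if "r \<in> K" for r
    using member_le_sum[of r K p] that K p0 p_sum by simp
  have "real (card T) * (1 / real R) \<le> sum p T"
    by (rule sum_bounded_below) (simp add: T_def)
  also have "\<dots> \<le> 1"
    using sum_mono2[OF K T(1), of p] p0 p_sum by auto
  finally have card: "card T \<le> R"
    using R by (simp add: field_simps)
  have term_nonneg: "0 \<le> - (p r * ln (p r))" if "r \<in> K" for r
    using p0[OF that] p1[OF that] by (cases "p r = 0") (auto simp: mult_nonneg_nonpos)
  have term_ge: "p r * ln (real R) \<le> - (p r * ln (p r))" if "r \<in> K - T" for r
  proof (cases "p r = 0")
    case False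
    then have "p r > 0"
      using p0[of r] that by simp
    moreover have "p r < 1 / real R"
      using that by (auto simp: T_def)
    ultimately have "ln (p r) \<le> ln (1 / real R)"
      by (intro ln_mono) auto
    also have "\<dots> = - ln (real R)"
      using R by (simp add: ln_div)
    finally have "p r * ln (real R) \<le> p r * (- ln (p r))"
      using \<open>p r > 0\<close> by (intro mult_left_mono) auto
    then show ?thesis by simp
  qed simp
  have HT: "(\<Sum>r\<in>K - T. - (p r * ln (p r))) \<le> b * ln (real R)"
  proof -
    have "(\<Sum>r\<in>K - T. - (p r * ln (p r))) \<le> (\<Sum>r\<in>K. - (p r * ln (p r)))"
      using K term_nonneg by (intro sum_mono2) auto
    then show ?thesis
      using H by (simp add: p_def sum_negf)
  qed
  have "sum p (K - T) \<le> b"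
  \<comment> \<open>With \<open>ln R = 0\<close> nothing can be divided out, but the entropy of the
    tail is then at most \<open>0\<close>. As \<open>T\<close> contains every index of probability
    \<open>1\<close>, all probabilities outside it must vanish.\<close>
  proof (cases "R = 1")
    case True
    have "p r = 0" if "r \<in> K - T" for r
    proof -
      have "(\<Sum>r\<in>K - T. - (p r * ln (p r))) = 0"
        using HT True sum_nonneg[of "K - T" "\<lambda>r. - (p r * ln (p r))"] term_nonneg by force
      then have "- (p r * ln (p r)) = 0"
        using that K term_nonneg sum_nonneg_eq_0_iff[of "K - T" "\<lambda>r. - (p r * ln (p r))"] by blast
      moreover have "p r < 1"
        using that True by (auto simp: T_def)
      ultimately show ?thesis
        using p0[of r] that by (cases "p r = 0") (auto simp: ln_eq_zero_iff)
    qed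
    then show ?thesis
      using b by simp
  next
    case False
    have "sum p (K - T) * ln (real R) \<le> b * ln (real R)"
      using sum_mono[of "K - T" "\<lambda>r. p r * ln (real R)", OF term_ge] HT
      by (simp add: sum_distrib_right)
    then show ?thesis
      using False R by simp
  qed
  then have "sum c (K - T) \<le> b * sum c K"
    using tot by (simp add: p_def sum_divide_distrib[symmetric] pos_divide_le_eq)
  then show ?thesis
    using T card by blast
qed

text \<open>The entropy depends on the matricization alone; this separates the matrix argument from
  the indexing of tensors.\<close>

definition mat_entropy :: "real mat \<Rightarrow> real" where
  "mat_entropy X =
     (let \<sigma>s = singular_values X;
          tot = sum_mset (image_mset (\<lambda>s. s\<^sup>2) \<sigma>s)
      in if tot = 0 then 0
         else - sum_mset (image_mset (\<lambda>s. (s\<^sup>2 / tot) * ln (s\<^sup>2 / tot)) \<sigma>s))"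

lemma QE_mat_entropy: "QE D M A J = mat_entropy (matricize D M A J)"
  by (simp add: QE_def mat_entropy_def)

text \<open>The entropy bound selects at most \<open>R\<close> left singular vectors that carry all
  but a fraction \<open>b\<close> of the squared norm; zero vectors fill the family up to
  \<open>R\<close>. Orthogonality of the coefficient rows \<open>w u r\<close> is recorded because
  for \<open>P = 1\<close> these rows, normalised, become the vectors of the second child of the
  root.\<close>

lemma low_rank_matrix:
  assumes X: "X \<in> carrier_mat m n" and R: "R > 0" and b: "b \<ge> 0"
    and H: "mat_entropy X \<le> b * ln (real R)"
  defines "w \<equiv> \<lambda>u r y. ip {..<m} (u r) (\<lambda>x. X $$ (x,y))"
  shows "\<exists>u :: nat \<Rightarrow> nat \<Rightarrow> real. suborthonormal {..<m} {..<R} u \<and>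
    (\<forall>r<R. \<forall>s<R. r \<noteq> s \<longrightarrow> ip {..<n} (w u r) (w u s) = 0) \<and>
    (\<Sum>x<m. \<Sum>y<n. (X $$ (x,y))\<^sup>2) - (\<Sum>r<R. ip {..<n} (w u r) (w u r))
      \<le> b * (\<Sum>x<m. \<Sum>y<n. (X $$ (x,y))\<^sup>2)"
proof -
  define t where "t = (\<Sum>x<m. \<Sum>y<n. (X $$ (x,y))\<^sup>2)"
  have t0: "t \<ge> 0"
    by (simp add: t_def sum_nonneg)
  obtain k u c where sv: "singular_values X = image_mset (\<lambda>r. sqrt (c r)) (mset_set {..<k})"
    and so: "suborthonormal {..<m} {..<k} u"
    and ww': "\<forall>r<k. \<forall>s<k. ip {..<n} (w u r) (w u s) = of_bool (r = s) * c s"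
    and tot: "(\<Sum>r<k. c r) = t"
    using thin_svd[OF X] unfolding w_def t_def by blast
  have ww: "ip {..<n} (w u r) (w u s) = of_bool (r = s) * c s" if "r < k" "s < k" for r s
    using ww' that by simp
  have c0: "c r \<ge> 0" if "r < k" for r
    using ww[OF that that] ip_self_nonneg[of "{..<n}" "w u r"] by simp
  show ?thesis
  proof (cases "t = 0")
    \<comment> \<open>For the zero matrix the zero family has no error.\<close>
    case True
    have "w (\<lambda>_ _. 0) r = (\<lambda>_. 0)" for r :: nat
      by (simp add: w_def ip_def)
    then show ?thesis
      using True by (intro exI[of _ "\<lambda>_ _. 0"]) (simp add: suborthonormal_def ip_def t_def[symmetric])
  next
    case False
    have s1: "sum_mset (image_mset (\<lambda>s. s\<^sup>2) (singular_values X)) = t"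
      using c0 by (simp add: sv multiset.map_comp o_def sum_unfold_sum_mset[symmetric] tot[symmetric])
    have s2: "sum_mset (image_mset (\<lambda>s. (s\<^sup>2 / t) * ln (s\<^sup>2 / t)) (singular_values X))
        = (\<Sum>r<k. (c r / t) * ln (c r / t))"
      using c0 by (simp add: sv multiset.map_comp o_def sum_unfold_sum_mset[symmetric])
    have "- (\<Sum>r<k. (c r / t) * ln (c r / t)) \<le> b * ln (real R)"
      using H False by (simp only: mat_entropy_def Let_def s1 s2 if_False)
    then obtain T where T: "T \<subseteq> {..<k}" "card T \<le> R" "sum c ({..<k} - T) \<le> b * t"
      using entropy_tail[of "{..<k}" c R b] c0 False t0 R b tot by auto
    have fT: "finite T"
      using T(1) finite_subset by blast
    obtain h where h: "bij_betw h {0..<card T} T"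
      using ex_bij_betw_nat_finite[OF fT] by blast
    define v where "v r = (if r < card T then u (h r) else (\<lambda>_. 0))" for r
    have hk: "h r < k" if "r < card T" for r
      using h that T(1) by (auto simp: bij_betw_def)
    have hinj: "h r = h s \<longleftrightarrow> r = s" if "r < card T" "s < card T" for r s
      using h that by (auto simp: bij_betw_def inj_on_def)
    have wv: "w v r = (if r < card T then w u (h r) else (\<lambda>_. 0))" for r
      by (auto simp: w_def v_def ip_def)
    have "suborthonormal {..<m} {..<R} v"
      using so hk hinj by (auto simp: suborthonormal_def v_def ip_def[of _ "\<lambda>_. 0"] ip_def[of _ _ "\<lambda>_. 0"])
    moreover have "ip {..<n} (w v r) (w v s) = 0" if "r \<noteq> s" for r s
      using that hk hinj by (auto simp: wv ww ip_def[of _ "\<lambda>_. 0"] ip_def[of _ _ "\<lambda>_. 0"])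
    moreover have "t - (\<Sum>r<R. ip {..<n} (w v r) (w v r)) \<le> b * t"
    proof -
      have "(\<Sum>r<R. ip {..<n} (w v r) (w v r)) = (\<Sum>r<R. if r < card T then c (h r) else 0)"
        by (intro sum.cong refl) (auto simp: wv ww hk ip_def[of _ "\<lambda>_. 0"])
      also have "\<dots> = (\<Sum>r\<in>{0..<card T}. c (h r))"
        using T(2) by (intro sum.mono_neutral_cong_right) auto
      also have "\<dots> = sum c T"
        by (rule sum.reindex_bij_betw[OF h])
      finally show ?thesis
        using T(3) sum_diff[OF finite_lessThan T(1), of c] tot by simp
    qed
    ultimately show ?thesis
      unfolding t_def by blast
  qed
qed

section \<open>Contractions of tensors along blocks of axes\<close>

text \<open>Pythagoras with the square completed in the coefficients. The condition on
  \<open>\<beta>\<close> concerns the zero vectors of the family: a nonzero coefficient there would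
  count in the last sum without changing the combination.\<close>

lemma ip_diff_combination:
  assumes X: "finite X" and T: "finite T" and u: "suborthonormal X T u"
    and b: "\<And>r. r \<in> T \<Longrightarrow> ip X (u r) (u r) = 0 \<Longrightarrow> \<beta> r = 0"
  shows "ip X (\<lambda>x. a x - (\<Sum>r\<in>T. \<beta> r * u r x)) (\<lambda>x. a x - (\<Sum>r\<in>T. \<beta> r * u r x))
    = ip X a a - (\<Sum>r\<in>T. (ip X (u r) a)\<^sup>2) + (\<Sum>r\<in>T. (ip X (u r) a - \<beta> r)\<^sup>2)"
proof -
  have "(\<Sum>s\<in>T. \<beta> s * ip X (u r) (u s)) = \<beta> r" if "r \<in> T" for r
  proof -
    have "(\<Sum>s\<in>T. \<beta> s * ip X (u r) (u s)) = (\<Sum>s\<in>T. if s = r then \<beta> r else 0)"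
    proof (rule sum.cong[OF refl])
      fix s assume s: "s \<in> T"
      show "\<beta> s * ip X (u r) (u s) = (if s = r then \<beta> r else 0)"
      proof (cases "s = r")
        case True
        then show ?thesis
          using u b[OF that] that by (auto simp: suborthonormal_def)
      next
        case False
        then have "ip X (u r) (u s) = 0"
          using u s that by (simp add: suborthonormal_def)
        then show ?thesis
          using False by simp
      qed
    qed
    then show ?thesis
      using that T by simp
  qed
  then have "ip X (\<lambda>x. a x - (\<Sum>r\<in>T. \<beta> r * u r x)) (\<lambda>x. a x - (\<Sum>r\<in>T. \<beta> r * u r x))
    = ip X a a - (\<Sum>r\<in>T. \<beta> r * ip X (u r) a) - ((\<Sum>r\<in>T. \<beta> r * ip X (u r) a) - (\<Sum>r\<in>T. \<beta> r * \<beta> r))"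
    by (simp add: ip_bilinear ip_commute[of X a "u _"] right_diff_distrib sum_subtractf)
  also have "\<dots> = ip X a a - (\<Sum>r\<in>T. (ip X (u r) a)\<^sup>2) + (\<Sum>r\<in>T. (ip X (u r) a - \<beta> r)\<^sup>2)"
  proof -
    have "(\<Sum>r\<in>T. (ip X (u r) a - \<beta> r)\<^sup>2) = (\<Sum>r\<in>T. (ip X (u r) a)\<^sup>2)
        - (\<Sum>r\<in>T. \<beta> r * ip X (u r) a) - (\<Sum>r\<in>T. \<beta> r * ip X (u r) a) + (\<Sum>r\<in>T. \<beta> r * \<beta> r)"
      unfolding sum.distrib[symmetric] sum_subtractf[symmetric]
      by (intro sum.cong refl) (simp add: power2_eq_square algebra_simps)
    then show ?thesis by simp
  qed
  finally show ?thesis .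
qed

lemma ip_eq_0: "finite X \<Longrightarrow> ip X f f = 0 \<Longrightarrow> ip X f g = 0"
  using ip_self_eq_0[of X f] by (simp add: ip_def)

lemma ip_self: "ip X f f = (\<Sum>x\<in>X. (f x)\<^sup>2)"
  by (simp add: ip_def power2_eq_square)

lemma bessel:
  assumes "finite X" "finite T" "suborthonormal X T u"
  shows "(\<Sum>r\<in>T. (ip X (u r) a)\<^sup>2) \<le> ip X a a"
proof -
  have "ip X (\<lambda>x. a x - (\<Sum>r\<in>T. ip X (u r) a * u r x)) (\<lambda>x. a x - (\<Sum>r\<in>T. ip X (u r) a * u r x))
    = ip X a a - (\<Sum>r\<in>T. (ip X (u r) a)\<^sup>2) + (\<Sum>r\<in>T. (ip X (u r) a - ip X (u r) a)\<^sup>2)"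
    by (rule ip_diff_combination[OF assms]) (rule ip_eq_0[OF assms(1)])
  then show ?thesis
    using ip_self_nonneg[of X "\<lambda>x. a x - (\<Sum>r\<in>T. ip X (u r) a * u r x)"] by simp
qed

text \<open>The error splits orthogonally into the part of \<open>a\<close> outside the span and the
  projection of \<open>a - b\<close>; Bessel bounds the latter. No relation between \<open>a\<close>
  and \<open>b\<close> is assumed, so squared errors of successive projections add.\<close>

lemma projection_error:
  assumes "finite X" "finite T" "suborthonormal X T u"
  shows "(\<Sum>x\<in>X. (a x - (\<Sum>r\<in>T. u r x * ip X (u r) b))\<^sup>2)
    \<le> (\<Sum>x\<in>X. (a x)\<^sup>2) - (\<Sum>r\<in>T. (ip X (u r) a)\<^sup>2) + (\<Sum>x\<in>X. (a x - b x)\<^sup>2)"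
proof -
  have "ip X (\<lambda>x. a x - (\<Sum>r\<in>T. ip X (u r) b * u r x)) (\<lambda>x. a x - (\<Sum>r\<in>T. ip X (u r) b * u r x))
    = ip X a a - (\<Sum>r\<in>T. (ip X (u r) a)\<^sup>2) + (\<Sum>r\<in>T. (ip X (u r) a - ip X (u r) b)\<^sup>2)"
    by (rule ip_diff_combination[OF assms]) (rule ip_eq_0[OF assms(1)])
  moreover have "(\<Sum>r\<in>T. (ip X (u r) a - ip X (u r) b)\<^sup>2) \<le> ip X (\<lambda>x. a x - b x) (\<lambda>x. a x - b x)"
    using bessel[OF assms, of "\<lambda>x. a x - b x"] by (simp add: ip_diff_right)
  moreover have "(\<Sum>x\<in>X. (a x - (\<Sum>r\<in>T. u r x * ip X (u r) b))\<^sup>2)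
      = ip X (\<lambda>x. a x - (\<Sum>r\<in>T. ip X (u r) b * u r x)) (\<lambda>x. a x - (\<Sum>r\<in>T. ip X (u r) b * u r x))"
    by (simp add: ip_self mult.commute)
  ultimately show ?thesis
    by (simp add: ip_self)
qed

section \<open>Multi-indices combined from complementary axes\<close>

definition glue :: "'i set \<Rightarrow> ('i \<Rightarrow> 'a) \<Rightarrow> ('i \<Rightarrow> 'a) \<Rightarrow> 'i \<Rightarrow> 'a" where
  "glue J x y = (\<lambda>n. if n \<in> J then x n else y n)"

lemma glue_glue_same [simp]: "glue J x (glue J y z) = glue J x z"
  by (auto simp: glue_def)

lemma glue_glue: "glue J x (glue K y z) = glue (J \<union> K) (glue J x y) z"
  by (auto simp: glue_def)

lemma glue_empty [simp]: "glue {} x y = y"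
  by (auto simp: glue_def)

lemma restrict_glue_same: "x \<in> PiE J F \<Longrightarrow> restrict (glue J x y) J = x"
  by (auto simp: glue_def restrict_def PiE_def extensional_def fun_eq_iff)

lemma restrict_glue_disjoint: "J \<inter> K = {} \<Longrightarrow> restrict (glue J x y) K = restrict y K"
  by (auto simp: glue_def restrict_def fun_eq_iff)

lemma restrict_glue_subset: "K \<subseteq> J \<Longrightarrow> restrict (glue J x y) K = restrict x K"
  by (auto simp: glue_def restrict_def fun_eq_iff)

lemma restrict_PiE_self: "x \<in> PiE J F \<Longrightarrow> restrict x J = x"
  by (auto simp: restrict_def PiE_def extensional_def fun_eq_iff)

lemma sum_PiE_glue:
  assumes "J \<inter> K = {}"
  shows "(\<Sum>i\<in>PiE (J \<union> K) F. f i) = (\<Sum>y\<in>PiE K F. \<Sum>x\<in>PiE J F. f (glue J x y))"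
proof -
  have split: "glue J (restrict i J) (restrict i K) = i" if "i \<in> PiE (J \<union> K) F" for i
    using that by (auto simp: glue_def restrict_def PiE_def extensional_def fun_eq_iff)
  have "(\<Sum>i\<in>PiE (J \<union> K) F. f i) = (\<Sum>(y,x)\<in>PiE K F \<times> PiE J F. f (glue J x y))"
  proof (rule sum.reindex_bij_witness[of _ "\<lambda>(y,x). glue J x y" "\<lambda>i. (restrict i K, restrict i J)"])
    fix yx assume "yx \<in> PiE K F \<times> PiE J F"
    then show "(restrict (case yx of (y, x) \<Rightarrow> glue J x y) K, restrict (case yx of (y, x) \<Rightarrow> glue J x y) J) = yx"
      using assms by (auto simp: restrict_glue_same restrict_glue_disjoint restrict_PiE_self)
    show "(case yx of (y, x) \<Rightarrow> glue J x y) \<in> PiE (J \<union> K) F"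
      using \<open>yx \<in> _\<close> by (auto simp: glue_def PiE_def extensional_def)
  qed (auto simp: split)
  then show ?thesis
    by (simp add: sum.cartesian_product)
qed

section \<open>Projections and contractions of blocks, and their errors\<close>

context
  fixes D :: "nat \<Rightarrow> nat" and R :: nat and S :: "nat set"
begin

definition idx :: "nat set \<Rightarrow> (nat \<Rightarrow> nat) set" where
  "idx J = PiE J (\<lambda>n. {..<D n})"

lemma finite_idx: "finite J \<Longrightarrow> finite (idx J)"
  unfolding idx_def by (intro finite_PiE) auto

lemma sum_idx_glue:
  assumes "J \<subseteq> S"
  shows "(\<Sum>i\<in>idx S. f i) = (\<Sum>y\<in>idx (S - J). \<Sum>x\<in>idx J. f (glue J x y))"
  using sum_PiE_glue[of J "S - J" f] assms by (simp add: idx_def Un_absorb1)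

definition sqnorm :: "((nat \<Rightarrow> nat) \<Rightarrow> real) \<Rightarrow> real" where
  "sqnorm f = (\<Sum>i\<in>idx S. (f i)\<^sup>2)"

text \<open>The result is still a function of a full multi-index, constant along the axes
  \<open>J\<close>, so contractions compose without a change of type.\<close>

definition block_coeff :: "nat set \<Rightarrow> (nat \<Rightarrow> (nat \<Rightarrow> nat) \<Rightarrow> real) \<Rightarrow> ((nat \<Rightarrow> nat) \<Rightarrow> real)
    \<Rightarrow> nat \<Rightarrow> (nat \<Rightarrow> nat) \<Rightarrow> real" where
  "block_coeff J U f r i = ip (idx J) (U r) (\<lambda>x. f (glue J x i))"

text \<open>Analysis with \<open>U\<close>, synthesis with \<open>\<Phi>\<close>. For
  \<open>\<Phi> = U\<close> this is the projection; for the tensors of a subtree as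
  \<open>\<Phi>\<close> it is the action of that subtree of the network.\<close>

definition contract :: "nat set \<Rightarrow> (nat \<Rightarrow> (nat \<Rightarrow> nat) \<Rightarrow> real) \<Rightarrow> (nat \<Rightarrow> (nat \<Rightarrow> nat) \<Rightarrow> real)
    \<Rightarrow> ((nat \<Rightarrow> nat) \<Rightarrow> real) \<Rightarrow> (nat \<Rightarrow> nat) \<Rightarrow> real" where
  "contract J U \<Phi> f i = (\<Sum>r<R. \<Phi> r i * block_coeff J U f r i)"

definition block_proj :: "nat set \<Rightarrow> (nat \<Rightarrow> (nat \<Rightarrow> nat) \<Rightarrow> real) \<Rightarrow> ((nat \<Rightarrow> nat) \<Rightarrow> real)
    \<Rightarrow> (nat \<Rightarrow> nat) \<Rightarrow> real" where
  "block_proj J U = contract J U (\<lambda>r i. U r (restrict i J))"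

lemma block_coeff_glue [simp]: "block_coeff J U f r (glue J x i) = block_coeff J U f r i"
  by (simp add: block_coeff_def)

text \<open>Stated for all \<open>B\<close>, not only \<open>B = A\<close>, so that the bounds of composed maps add.\<close>

definition error_bounded :: "((nat \<Rightarrow> nat) \<Rightarrow> real) \<Rightarrow> real
    \<Rightarrow> (((nat \<Rightarrow> nat) \<Rightarrow> real) \<Rightarrow> (nat \<Rightarrow> nat) \<Rightarrow> real) \<Rightarrow> bool" where
  "error_bounded A c F \<longleftrightarrow> (\<forall>B. sqnorm (\<lambda>i. A i - F B i) \<le> c + sqnorm (\<lambda>i. A i - B i))"

lemma error_bounded_id: "error_bounded A 0 (\<lambda>f. f)"
  by (simp add: error_bounded_def)

lemma error_bounded_comp:
  assumes "error_bounded A c F" "error_bounded A d G"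
  shows "error_bounded A (c + d) (\<lambda>f. F (G f))"
  unfolding error_bounded_def
proof
  fix B
  have "sqnorm (\<lambda>i. A i - F (G B) i) \<le> c + sqnorm (\<lambda>i. A i - G B i)"
    using assms(1) by (simp add: error_bounded_def)
  also have "sqnorm (\<lambda>i. A i - G B i) \<le> d + sqnorm (\<lambda>i. A i - B i)"
    using assms(2) by (simp add: error_bounded_def)
  finally show "sqnorm (\<lambda>i. A i - F (G B) i) \<le> c + d + sqnorm (\<lambda>i. A i - B i)"
    by simp
qed

lemma error_bounded_mono: "error_bounded A c F \<Longrightarrow> c \<le> d \<Longrightarrow> error_bounded A d F"
  by (force simp: error_bounded_def intro: order_trans)

text \<open>For suborthonormal \<open>U\<close> this is the squared distance of \<open>A\<close>
  from its block projection, written through Pythagoras so that it is the sum of the discarded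
  squared singular values.\<close>

definition residual :: "((nat \<Rightarrow> nat) \<Rightarrow> real) \<Rightarrow> nat set \<Rightarrow> (nat \<Rightarrow> (nat \<Rightarrow> nat) \<Rightarrow> real) \<Rightarrow> real" where
  "residual A J U = sqnorm A - (\<Sum>r<R. ip (idx (S - J)) (block_coeff J U A r) (block_coeff J U A r))"

text \<open>\<open>projection_error\<close> holds on each slice with the axes outside
  \<open>J\<close> fixed; the slices are then summed.\<close>

lemma error_bounded_block_proj:
  assumes S: "finite S" and J: "J \<subseteq> S" and U: "suborthonormal (idx J) {..<R} U"
  shows "error_bounded A (residual A J U) (block_proj J U)"
  unfolding error_bounded_def
proof
  fix B
  have fJ: "finite (idx J)"
    using S J by (intro finite_idx) (rule finite_subset)
  have "sqnorm (\<lambda>i. A i - block_proj J U B i)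
      = (\<Sum>y\<in>idx (S - J). \<Sum>x\<in>idx J. (A (glue J x y) - (\<Sum>r<R. U r x * block_coeff J U B r y))\<^sup>2)"
    unfolding sqnorm_def sum_idx_glue[OF J]
    by (intro sum.cong refl) (simp add: block_proj_def contract_def restrict_glue_same idx_def)
  also have "\<dots> \<le> (\<Sum>y\<in>idx (S - J). (\<Sum>x\<in>idx J. (A (glue J x y))\<^sup>2)
      - (\<Sum>r<R. (block_coeff J U A r y)\<^sup>2) + (\<Sum>x\<in>idx J. (A (glue J x y) - B (glue J x y))\<^sup>2))"
    unfolding block_coeff_def by (intro sum_mono projection_error fJ U) simp
  also have "\<dots> = residual A J U + sqnorm (\<lambda>i. A i - B i)"
  proof -
    have "(\<Sum>y\<in>idx (S - J). \<Sum>r<R. (block_coeff J U A r y)\<^sup>2)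
        = (\<Sum>r<R. ip (idx (S - J)) (block_coeff J U A r) (block_coeff J U A r))"
      by (subst sum.swap) (simp add: ip_def power2_eq_square)
    then show ?thesis
      by (simp add: residual_def sqnorm_def sum_idx_glue[OF J] sum.distrib sum_subtractf)
  qed
  finally show "sqnorm (\<lambda>i. A i - block_proj J U B i) \<le> residual A J U + sqnorm (\<lambda>i. A i - B i)" .
qed

text \<open>Index tuples of arbitrary length allow induction on the number of children; the network
  uses length \<open>2^P\<close>.\<close>

definition words :: "nat \<Rightarrow> nat list set" where
  "words m = {ks. length ks = m \<and> set ks \<subseteq> {..<R}}"

lemma sum_words_Suc: "(\<Sum>ks\<in>words (Suc m). f ks) = (\<Sum>r<R. \<Sum>ks\<in>words m. f (ks @ [r]))"
proof -
  have "(\<Sum>ks\<in>words (Suc m). f ks) = (\<Sum>(r,ks)\<in>{..<R} \<times> words m. f (ks @ [r]))"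
  proof (rule sum.reindex_bij_witness[of _ "\<lambda>(r,ks). ks @ [r]" "\<lambda>ks. (last ks, butlast ks)"])
    fix ks assume ks: "ks \<in> words (Suc m)"
    then have "ks \<noteq> []" and l: "length ks = Suc m" and s: "set ks \<subseteq> {..<R}"
      by (auto simp: words_def)
    then have "last ks \<in> set ks" "set (butlast ks) \<subseteq> set ks"
      by (auto dest: in_set_butlastD)
    with s l show "(last ks, butlast ks) \<in> {..<R} \<times> words m"
      by (auto simp: words_def)
    show "(case (last ks, butlast ks) of (r, ks) \<Rightarrow> ks @ [r]) = ks"
      using \<open>ks \<noteq> []\<close> by simp
    then show "(case (last ks, butlast ks) of (r, ks) \<Rightarrow> f (ks @ [r])) = f ks"
      by simp
  qed (auto simp: words_def)
  then show ?thesis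
    by (simp add: sum.cartesian_product)
qed

text \<open>All children are contracted in a single sum over index tuples, which is the shape of one
  core of the network.\<close>

definition multi_contract :: "nat \<Rightarrow> (nat \<Rightarrow> nat set) \<Rightarrow> (nat \<Rightarrow> nat \<Rightarrow> (nat \<Rightarrow> nat) \<Rightarrow> real)
    \<Rightarrow> (nat \<Rightarrow> nat \<Rightarrow> (nat \<Rightarrow> nat) \<Rightarrow> real) \<Rightarrow> ((nat \<Rightarrow> nat) \<Rightarrow> real) \<Rightarrow> (nat \<Rightarrow> nat) \<Rightarrow> real" where
  "multi_contract m J U \<Phi> f i = (\<Sum>ks\<in>words m.
     ip (idx (\<Union>k<m. J k)) (\<lambda>x. f (glue (\<Union>k<m. J k) x i))
       (\<lambda>x. \<Prod>k<m. U k (ks ! k) (restrict x (J k))) * (\<Prod>k<m. \<Phi> k (ks ! k) i))"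

lemma multi_contract_0: "multi_contract 0 J U \<Phi> f = f"
proof
  fix i
  have "words 0 = {[]}" "idx {} = {\<lambda>_. undefined}"
    by (auto simp: words_def idx_def)
  then show "multi_contract 0 J U \<Phi> f i = f i"
    by (simp add: multi_contract_def ip_def)
qed

text \<open>By Fubini over disjoint blocks, contracting simultaneously is contracting one block
  after another. The sum over the axes \<open>J m\<close> passes by the earlier
  \<open>\<Phi> k\<close> because these do not depend on \<open>J m\<close>.\<close>

lemma multi_contract_Suc:
  assumes disj: "\<And>k. k < m \<Longrightarrow> J k \<inter> J m = {}"
    and local: "\<And>k r x i. k < m \<Longrightarrow> \<Phi> k r (glue (J m) x i) = \<Phi> k r i"
  shows "multi_contract (Suc m) J U \<Phi> f = contract (J m) (U m) (\<Phi> m) (multi_contract m J U \<Phi> f)"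
proof
  fix i
  define K where "K = (\<Union>k<m. J k)"
  have Union_Suc: "(\<Union>k<Suc m. J k) = K \<union> J m"
    by (auto simp: K_def less_Suc_eq)
  have KJ: "K \<inter> J m = {}"
    using disj by (auto simp: K_def)
  define p where "p ks x = (\<Prod>k<m. U k (ks ! k) (restrict x (J k)))" for ks x
  define q where "q ks = (\<Prod>k<m. \<Phi> k (ks ! k) i)" for ks
  have len: "length ks = m" if "ks \<in> words m" for ks
    using that by (simp add: words_def)
  have nth: "(\<Prod>k<m. h k ((ks @ [r]) ! k)) = (\<Prod>k<m. h k (ks ! k))" if "ks \<in> words m"
    for ks r and h :: "nat \<Rightarrow> nat \<Rightarrow> real"
    using len[OF that] by (intro prod.cong refl) (simp add: nth_append)
  have pglue: "p ks (glue K x y) = p ks x" for ks x y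
    unfolding p_def by (intro prod.cong refl) (subst restrict_glue_subset, auto simp: K_def)
  have "multi_contract (Suc m) J U \<Phi> f i = (\<Sum>r<R. \<Sum>ks\<in>words m.
      ip (idx (K \<union> J m)) (\<lambda>x. f (glue (K \<union> J m) x i)) (\<lambda>x. p ks x * U m r (restrict x (J m)))
      * (q ks * \<Phi> m r i))"
    unfolding multi_contract_def sum_words_Suc
  proof (intro sum.cong refl, goal_cases)
    case (1 r ks)
    then show ?case
      using len[OF 1(2)] by (simp add: Union_Suc nth p_def q_def nth_append)
  qed
  also have "\<dots> = (\<Sum>r<R. \<Sum>ks\<in>words m. \<Sum>y\<in>idx (J m). \<Sum>x\<in>idx K.
      f (glue (K \<union> J m) (glue K x y) i) * (p ks x * U m r y) * (q ks * \<Phi> m r i))"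
  proof (intro sum.cong refl, goal_cases)
    case (1 r ks)
    have "ip (idx (K \<union> J m)) (\<lambda>x. f (glue (K \<union> J m) x i)) (\<lambda>x. p ks x * U m r (restrict x (J m)))
      = (\<Sum>y\<in>idx (J m). \<Sum>x\<in>idx K. f (glue (K \<union> J m) (glue K x y) i) * (p ks x * U m r y))"
      unfolding ip_def idx_def sum_PiE_glue[OF KJ]
      by (intro sum.cong refl)
        (simp add: pglue restrict_glue_disjoint[OF KJ] restrict_PiE_self)
    then show ?case
      by (simp add: sum_distrib_right)
  qed
  also have "\<dots> = (\<Sum>r<R. \<Sum>y\<in>idx (J m). \<Sum>ks\<in>words m. \<Sum>x\<in>idx K.
      f (glue (K \<union> J m) (glue K x y) i) * (p ks x * U m r y) * (q ks * \<Phi> m r i))"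
    by (rule sum.cong[OF refl], rule sum.swap)
  also have "\<dots> = (\<Sum>r<R. \<Phi> m r i * (\<Sum>y\<in>idx (J m). U m r y *
      (\<Sum>ks\<in>words m. (\<Sum>x\<in>idx K. f (glue K x (glue (J m) y i)) * p ks x) * q ks)))"
    unfolding sum_distrib_left sum_distrib_right glue_glue
    by (intro sum.cong refl) (simp only: mult_ac)
  also have "\<dots> = contract (J m) (U m) (\<Phi> m) (multi_contract m J U \<Phi> f) i"
    unfolding contract_def block_coeff_def multi_contract_def ip_def
    by (simp add: local K_def[symmetric] p_def[symmetric] q_def[symmetric])
  finally show "multi_contract (Suc m) J U \<Phi> f i
      = contract (J m) (U m) (\<Phi> m) (multi_contract m J U \<Phi> f) i" .
qed

lemma error_bounded_multi_contract:
  assumes disj: "\<And>k k'. k < k' \<Longrightarrow> k' < m \<Longrightarrow> J k \<inter> J k' = {}"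
    and local: "\<And>k k' r x i. k < k' \<Longrightarrow> k' < m \<Longrightarrow> \<Phi> k r (glue (J k') x i) = \<Phi> k r i"
    and err: "\<And>k. k < m \<Longrightarrow> error_bounded A c (contract (J k) (U k) (\<Phi> k))"
  shows "error_bounded A (real m * c) (multi_contract m J U \<Phi>)"
  using assms
proof (induction m)
  case 0
  then show ?case
    using error_bounded_id by (simp add: multi_contract_0[abs_def])
next
  case (Suc m)
  have eq: "multi_contract (Suc m) J U \<Phi> = (\<lambda>f. contract (J m) (U m) (\<Phi> m) (multi_contract m J U \<Phi> f))"
    using multi_contract_Suc[of m J \<Phi> U] Suc.prems(1,2) by blast
  have "error_bounded A (c + real m * c) (multi_contract (Suc m) J U \<Phi>)"
    unfolding eq
  proof (rule error_bounded_comp[where F = "contract (J m) (U m) (\<Phi> m)" and G = "multi_contract m J U \<Phi>"])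
    show "error_bounded A c (contract (J m) (U m) (\<Phi> m))"
      by (rule Suc.prems(3)) simp
    show "error_bounded A (real m * c) (multi_contract m J U \<Phi>)"
      by (rule Suc.IH) (simp_all add: Suc.prems)
  qed
  then show ?case
    by (simp add: algebra_simps)
qed

text \<open>This is the descent from a node to its children. Once the projection onto the
  \<open>V r\<close> has been applied, the inner product with a child product is the sum over
  \<open>r\<close> of the coefficient times the core entry, which is what the expansion of
  \<open>\<Phi>\<close> collects.\<close>

lemma contract_eq_multi_contract:
  assumes \<Phi>: "\<And>r i. \<Phi> r i = (\<Sum>ks\<in>words m. ip (idx K) (V r)
      (\<lambda>x. \<Prod>k<m. U k (ks ! k) (restrict x (J k))) * (\<Prod>k<m. \<Psi> k (ks ! k) i))"
    and K: "K = (\<Union>k<m. J k)"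
  shows "contract K V \<Phi> f = multi_contract m J U \<Psi> (block_proj K V f)"
proof
  fix i
  define p where "p ks x = (\<Prod>k<m. U k (ks ! k) (restrict x (J k)))" for ks x
  have "ip (idx K) (\<lambda>x. block_proj K V f (glue K x i)) (p ks)
      = (\<Sum>r<R. block_coeff K V f r i * ip (idx K) (V r) (p ks))" for ks
  proof -
    have "ip (idx K) (\<lambda>x. block_proj K V f (glue K x i)) (p ks)
        = ip (idx K) (\<lambda>x. \<Sum>r<R. block_coeff K V f r i * V r x) (p ks)"
      by (rule ip_cong) (simp_all add: block_proj_def contract_def idx_def restrict_glue_same mult.commute)
    then show ?thesis
      by (simp add: ip_bilinear)
  qed
  then have "multi_contract m J U \<Psi> (block_proj K V f) i = (\<Sum>ks\<in>words m. \<Sum>r<R.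
      block_coeff K V f r i * ip (idx K) (V r) (p ks) * (\<Prod>k<m. \<Psi> k (ks ! k) i))"
    unfolding multi_contract_def K[symmetric] p_def by (simp add: sum_distrib_right)
  also have "\<dots> = contract K V \<Phi> f i"
  proof -
    have "\<Phi> r i = (\<Sum>ks\<in>words m. ip (idx K) (V r) (p ks) * (\<Prod>k<m. \<Psi> k (ks ! k) i))" for r
      by (simp add: \<Phi> p_def[abs_def])
    then show ?thesis
      unfolding contract_def
      by (subst sum.swap) (simp add: sum_distrib_left mult_ac)
  qed
  finally show "contract K V \<Phi> f i = multi_contract m J U \<Psi> (block_proj K V f) i" ..
qed

end

section \<open>The tree network\<close>

definition blk :: "nat \<Rightarrow> nat \<Rightarrow> nat \<Rightarrow> nat set" where
  "blk P l n = {2^(P*l)*(n-1)+1 .. 2^(P*l)*n}"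

definition child :: "nat \<Rightarrow> nat \<Rightarrow> nat \<Rightarrow> nat" where
  "child P n k = 2^P*(n-1) + k + 1"

text \<open>The 1-based intervals become fibres of integer division, which yields disjointness and
  the splitting into children.\<close>

lemma mem_blk_iff:
  assumes "n \<ge> 1"
  shows "i \<in> blk P l n \<longleftrightarrow> i \<ge> 1 \<and> (i - 1) div 2^(P*l) = n - 1"
proof -
  define q :: nat where "q = 2^(P*l)"
  have q: "q > 0" by (simp add: q_def)
  obtain m where n: "n = Suc m"
    using assms by (cases n) auto
  have "i \<in> blk P l n \<longleftrightarrow> i \<ge> 1 \<and> m * q \<le> i - 1 \<and> i - 1 < Suc m * q"
    by (auto simp: blk_def n q_def[symmetric] mult.commute)
  also have "m * q \<le> i - 1 \<and> i - 1 < Suc m * q \<longleftrightarrow> (i - 1) div q = m"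
    using q div_nat_eqI[of q m "i - 1"] dividend_less_div_times[OF q, of "i - 1"]
      div_times_less_eq_dividend[of "i - 1" q] by (auto simp: mult.commute)
  finally show ?thesis
    by (simp add: n q_def)
qed

lemma child_ge_1 [simp]: "Suc 0 \<le> child P n k"
  by (simp add: child_def)

lemma blk_disjoint: "n \<ge> 1 \<Longrightarrow> m \<ge> 1 \<Longrightarrow> n \<noteq> m \<Longrightarrow> blk P l n \<inter> blk P l m = {}"
  by (auto simp: mem_blk_iff)

lemma blk_Suc:
  assumes n: "n \<ge> 1"
  shows "blk P (Suc l) n = (\<Union>k<2^P. blk P l (child P n k))"
proof (rule Set.set_eqI)
  fix i :: nat
  have "(2::nat)^(P * Suc l) = 2^(P*l) * 2^P"
    by (simp add: power_add)
  then have "(i - 1) div 2^(P * Suc l) = (i - 1) div 2^(P*l) div 2^P"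
    by (simp only: div_mult2_eq)
  moreover have "x div 2^P = n - 1 \<longleftrightarrow> (\<exists>k<2^P. x = child P n k - 1)" for x :: nat
  proof
    assume "x div 2^P = n - 1"
    then have "x = child P n (x mod 2^P) - 1"
      by (metis add_diff_cancel_right' child_def mult_div_mod_eq)
    then show "\<exists>k<2^P. x = child P n k - 1"
      by (metis mod_less_divisor zero_less_numeral zero_less_power)
  qed (auto simp: child_def)
  ultimately show "i \<in> blk P (Suc l) n \<longleftrightarrow> i \<in> (\<Union>k<2^P. blk P l (child P n k))"
    using n by (auto simp: mem_blk_iff child_ge_1)
qed

lemma blk_subset:
  assumes "l \<le> L" "n \<in> {1..2^(P*(L-l))}"
  shows "blk P l n \<subseteq> {1..2^(P*L)}"
proof -
  have "(2::nat)^(P*l) * n \<le> 2^(P*l) * 2^(P*(L-l))"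
    using assms by simp
  also have "\<dots> = 2^(P*L)"
    using assms(1) by (simp add: power_add[symmetric] add_mult_distrib2[symmetric])
  finally show ?thesis
    by (auto simp: blk_def)
qed

lemma child_in_range:
  assumes "Suc l \<le> L" "n \<in> {1..2^(P*(L - Suc l))}" "k < 2^P"
  shows "child P n k \<in> {1..2^(P*(L-l))}"
proof -
  obtain m where n: "n = Suc m"
    using assms(2) by (cases n) auto
  have "child P n k \<le> 2^P * n"
    using assms(3) by (simp add: child_def n)
  also have "\<dots> \<le> 2^P * 2^(P*(L - Suc l))"
    using assms(2) by simp
  also have "\<dots> = 2^(P * Suc (L - Suc l))"
    by (simp add: power_add)
  also have "Suc (L - Suc l) = L - l"
    using assms(1) by simp
  finally show ?thesis
    by (simp add: child_def)
qed

lemma tuples_eq_words: "tuples P R = words R (2^P)"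
  by (simp add: tuples_def words_def)

lemma tn_phi_Suc:
  "tn_phi phi0 a P R (Suc l) n r i = (\<Sum>ks\<in>words R (2^P). a (Suc l) n r ks *
     (\<Prod>k<2^P. tn_phi phi0 a P R l (child P n k) (ks ! k) i))"
  by (simp add: child_def tuples_eq_words)

lemma tn_phi_local:
  assumes "n \<ge> 1" "\<And>j. j \<in> blk P l n \<Longrightarrow> i j = i' j"
  shows "tn_phi phi0 a P R l n r i = tn_phi phi0 a P R l n r i'"
  using assms
proof (induction l arbitrary: n r)
  case 0
  then have "n \<in> blk P 0 n"
    by (simp add: blk_def)
  then show ?case
    using 0 by simp
next
  case (Suc l)
  have "tn_phi phi0 a P R l (child P n k) s i = tn_phi phi0 a P R l (child P n k) s i'" if "k < 2^P" for k s
    using that Suc.prems by (intro Suc.IH) (auto simp: blk_Suc child_ge_1)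
  then show ?case
    by (simp add: child_def)
qed

section \<open>Network tensors built from the vectors chosen at the nodes\<close>

context
  fixes D :: "nat \<Rightarrow> nat" and P R :: nat
    and U :: "nat \<Rightarrow> nat \<Rightarrow> nat \<Rightarrow> (nat \<Rightarrow> nat) \<Rightarrow> real"
begin

definition child_prod :: "nat \<Rightarrow> nat \<Rightarrow> nat list \<Rightarrow> (nat \<Rightarrow> nat) \<Rightarrow> real" where
  "child_prod l n ks x =
     (\<Prod>k<2^P. U l (child P n k) (ks ! k) (restrict x (blk P l (child P n k))))"

text \<open>The restricted constant function is the multi-index of the single axis \<open>n\<close>
  with entry \<open>v\<close>.\<close>

definition net_leaf :: "nat \<Rightarrow> nat \<Rightarrow> nat \<Rightarrow> real" where
  "net_leaf n r v = U 0 n r (restrict (\<lambda>_. v) {n})"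

text \<open>The predecessor appears because a core at level \<open>l\<close> joins children at level
  \<open>l - 1\<close>; \<open>tn_phi\<close> evaluates cores at positive levels only.\<close>

definition net_core :: "nat \<Rightarrow> nat \<Rightarrow> nat \<Rightarrow> nat list \<Rightarrow> real" where
  "net_core l n r ks = ip (idx D (blk P l n)) (U l n r) (child_prod (l - 1) n ks)"

abbreviation net_phi :: "nat \<Rightarrow> nat \<Rightarrow> nat \<Rightarrow> (nat \<Rightarrow> nat) \<Rightarrow> real" where
  "net_phi \<equiv> tn_phi net_leaf net_core P R"

text \<open>The action of the tree strictly below a node: the projection at \<open>(l, n)\<close>
  itself is left out, so the root needs no vectors of its own.\<close>

primrec net :: "nat \<Rightarrow> nat \<Rightarrow> ((nat \<Rightarrow> nat) \<Rightarrow> real) \<Rightarrow> (nat \<Rightarrow> nat) \<Rightarrow> real" where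
  "net 0 n = (\<lambda>f. f)"
| "net (Suc l) n = multi_contract D R (2^P) (\<lambda>k. blk P l (child P n k))
     (\<lambda>k. U l (child P n k)) (\<lambda>k. net_phi l (child P n k))"

lemma net_phi_glue:
  assumes "n \<ge> 1" "m \<ge> 1" "n \<noteq> m"
  shows "net_phi l n r (glue (blk P l m) x i) = net_phi l n r i"
  using assms blk_disjoint[OF assms(1,2,3), of P l]
  by (intro tn_phi_local) (auto simp: glue_def)

text \<open>The projection at the node is split off and the rest is left to the children. At a leaf
  nothing is left, as its network vectors are the \<open>U 0 n r\<close> themselves.\<close>

lemma contract_net_phi:
  assumes n: "n \<ge> 1"
  shows "contract D R (blk P l n) (U l n) (net_phi l n) f = net l n (block_proj D R (blk P l n) (U l n) f)"
proof (cases l)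
  case 0
  have "blk P 0 n = {n}"
    using n by (auto simp: blk_def)
  moreover have "restrict (\<lambda>_. i n) {n} = restrict i {n}" for i :: "nat \<Rightarrow> nat"
    by (auto simp: restrict_def)
  ultimately show ?thesis
    by (intro ext) (simp add: 0 block_proj_def net_leaf_def contract_def)
next
  case (Suc l')
  show ?thesis
    unfolding Suc net.simps
  proof (rule contract_eq_multi_contract)
    show "net_phi (Suc l') n r i = (\<Sum>ks\<in>words R (2^P). ip (idx D (blk P (Suc l') n)) (U (Suc l') n r)
      (\<lambda>x. \<Prod>k<2^P. U l' (child P n k) (ks ! k) (restrict x (blk P l' (child P n k))))
      * (\<Prod>k<2^P. net_phi l' (child P n k) (ks ! k) i))" for r i
      by (simp add: tn_phi_Suc net_core_def child_prod_def[abs_def] del: tn_phi.simps)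
    show "blk P (Suc l') n = (\<Union>k<2^P. blk P l' (child P n k))"
      by (rule blk_Suc[OF n])
  qed
qed

lemma contract_net_phi_eta:
  assumes "n \<ge> 1"
  shows "contract D R (blk P l n) (U l n) (net_phi l n)
    = (\<lambda>f. net l n (block_proj D R (blk P l n) (U l n) f))"
  using contract_net_phi[OF assms] by blast

definition good_node :: "((nat \<Rightarrow> nat) \<Rightarrow> real) \<Rightarrow> nat \<Rightarrow> real \<Rightarrow> nat \<Rightarrow> nat \<Rightarrow> bool" where
  "good_node A L \<delta> l n \<longleftrightarrow> suborthonormal (idx D (blk P l n)) {..<R} (U l n) \<and>
     residual D R {1..2^(P*L)} A (blk P l n) (U l n) \<le> \<delta>"

end

section \<open>Accumulation of the errors over the tree\<close>

primrec num_below :: "nat \<Rightarrow> nat \<Rightarrow> nat" where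
  "num_below P 0 = 0"
| "num_below P (Suc l) = 2^P * (num_below P l + 1)"

text \<open>\<open>num_below\<close> counts the proper descendants of a node, hence the projections
  in \<open>net\<close>. From \<open>2^P \<ge> 4\<close> the constant \<open>3\<close> is available
  at the first level, and multiplication by \<open>2^P\<close> preserves it. For
  \<open>P = 1\<close> the count is larger than this bound allows by one.\<close>

lemma num_below_bound:
  assumes "P \<ge> 2" "l > 0"
  shows "num_below P l + 3 \<le> 2 * 2^(P*l)"
  using assms(2)
proof (induction l rule: nat_induct_non_zero)
  case 1
  have "(2::nat)^2 \<le> 2^P"
    using assms(1) by (intro power_increasing) auto
  then show ?case by simp
next
  case (Suc l)
  have "(2::nat)^2 \<le> 2^P"
    using assms(1) by (intro power_increasing) auto
  moreover have "2^P * (num_below P l + 3) \<le> 2^P * (2 * 2^(P*l))"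
    using Suc.IH by (intro mult_le_mono2)
  ultimately show ?case
    by (simp add: power_add algebra_simps)
qed

lemma num_below_1: "num_below 1 l + 2 = 2 * 2^l"
  by (induction l) simp_all

lemma error_bounded_contract_net_phi:
  assumes n: "l \<le> L" "n \<in> {1..2^(P*(L-l))}" and g: "good_node D P R U A L \<delta> l n"
    and net: "error_bounded D {1..2^(P*L)} A c (net D P R U l n)"
  shows "error_bounded D {1..2^(P*L)} A (c + \<delta>)
    (contract D R (blk P l n) (U l n) (tn_phi (net_leaf U) (net_core D P U) P R l n))"
proof -
  have n1: "n \<ge> 1"
    using n by simp
  have "error_bounded D {1..2^(P*L)} A (residual D R {1..2^(P*L)} A (blk P l n) (U l n))
      (block_proj D R (blk P l n) (U l n))"
    using g blk_subset[OF n] by (intro error_bounded_block_proj) (auto simp: good_node_def)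
  moreover have "residual D R {1..2^(P*L)} A (blk P l n) (U l n) \<le> \<delta>"
    using g by (simp add: good_node_def)
  ultimately have "error_bounded D {1..2^(P*L)} A \<delta> (block_proj D R (blk P l n) (U l n))"
    by (rule error_bounded_mono)
  from error_bounded_comp[OF net this] show ?thesis
    unfolding contract_net_phi_eta[OF n1] .
qed

text \<open>Each of the \<open>2^P\<close> children costs \<open>\<delta>\<close> for its own
  projection plus the cost of its descendants, which is the recursion of
  \<open>num_below\<close>.\<close>

lemma error_bounded_net:
  assumes "l \<le> L" "n \<in> {1..2^(P*(L-l))}"
    and "\<And>l' n'. l' < l \<Longrightarrow> n' \<in> {1..2^(P*(L-l'))} \<Longrightarrow> good_node D P R U A L \<delta> l' n'"
  shows "error_bounded D {1..2^(P*L)} A (real (num_below P l) * \<delta>) (net D P R U l n)"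
  using assms
proof (induction l arbitrary: n)
  case 0
  then show ?case
    using error_bounded_id by simp
next
  case (Suc l)
  have "error_bounded D {1..2^(P*L)} A (real (2^P) * (real (num_below P l) * \<delta> + \<delta>))
     (multi_contract D R (2^P) (\<lambda>k. blk P l (child P n k)) (\<lambda>k. U l (child P n k))
       (\<lambda>k. tn_phi (net_leaf U) (net_core D P U) P R l (child P n k)))"
  proof (rule error_bounded_multi_contract)
    show "blk P l (child P n k) \<inter> blk P l (child P n k') = {}" if "k < k'" for k k'
      using that by (intro blk_disjoint) (auto simp: child_def)
    show "tn_phi (net_leaf U) (net_core D P U) P R l (child P n k) r (glue (blk P l (child P n k')) x i)
       = tn_phi (net_leaf U) (net_core D P U) P R l (child P n k) r i" if "k < k'" for k k' r x i
      using that by (intro net_phi_glue) (auto simp: child_def)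
    show "error_bounded D {1..2^(P*L)} A (real (num_below P l) * \<delta> + \<delta>)
       (contract D R (blk P l (child P n k)) (U l (child P n k))
         (tn_phi (net_leaf U) (net_core D P U) P R l (child P n k)))" if k: "k < 2^P" for k
    proof (rule error_bounded_contract_net_phi)
      show c: "child P n k \<in> {1..2^(P*(L-l))}"
        by (rule child_in_range[OF Suc.prems(1,2) k])
      show "l \<le> L"
        using Suc.prems(1) by simp
      show "good_node D P R U A L \<delta> l (child P n k)"
        by (rule Suc.prems(3)) (use c in auto)
      show "error_bounded D {1..2^(P*L)} A (real (num_below P l) * \<delta>) (net D P R U l (child P n k))"
        by (rule Suc.IH) (use Suc.prems c in auto)
    qed
  qed
  then show ?case
    by (simp add: algebra_simps)
qed

text \<open>The root core consists of the inner products of \<open>A\<close> itself with the child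
  products. Validity of \<open>i\<close> matters outside the axes, where it makes
  \<open>glue\<close> return \<open>x\<close>.\<close>

lemma tn_W_eq_net:
  assumes L: "L > 0" and i: "i \<in> idx D {1..2^(P*L)}"
  shows "tn_W (net_leaf U) (net_core D P U)
      (\<lambda>ks. ip (idx D {1..2^(P*L)}) A (child_prod P U (L - 1) 1 ks)) P L R i = net D P R U L 1 A i"
proof -
  obtain l where l: "L = Suc l"
    using L by (cases L) auto
  have S: "(\<Union>k<2^P. blk P l (child P 1 k)) = {1..2^(P*L)}"
    by (subst blk_Suc[symmetric]) (auto simp: blk_def l)
  have "glue {1..2^(P*L)} x i = x" if "x \<in> idx D {1..2^(P*L)}" for x
    using that i by (auto simp: glue_def idx_def PiE_def extensional_def)
  then have "ip (idx D {1..2^(P*L)}) (\<lambda>x. A (glue {1..2^(P*L)} x i)) h = ip (idx D {1..2^(P*L)}) A h" for h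
    by (intro ip_cong) auto
  then show ?thesis
    unfolding l net.simps multi_contract_def S[unfolded l]
    by (simp add: tn_W_def tuples_eq_words child_prod_def[abs_def] child_def l)
qed

text \<open>When \<open>block_coeff D J U A r\<close> vanishes, the division by zero makes \<open>V r\<close> zero as intended.\<close>

lemma row_space_block_proj:
  fixes A :: "(nat \<Rightarrow> nat) \<Rightarrow> real"
  assumes fin: "finite K" and disj: "J \<inter> K = {}"
    and orth: "\<And>r s. r < R \<Longrightarrow> s < R \<Longrightarrow> r \<noteq> s \<Longrightarrow> ip (idx D K) (block_coeff D J U A r) (block_coeff D J U A s) = 0"
    and local: "\<And>r x i. \<Phi> r (glue K x i) = \<Phi> r i"
    and V: "\<And>r y. V r y = (1 / sqrt (ip (idx D K) (block_coeff D J U A r) (block_coeff D J U A r))) * block_coeff D J U A r y"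
  shows "suborthonormal (idx D K) {..<R} V"
    and "i \<in> idx D (J \<union> K) \<Longrightarrow> block_proj D R K V (contract D R J U \<Phi> A) i = contract D R J U \<Phi> A i"
proof -
  define w where "w r = block_coeff D J U A r" for r
  define c where "c r = ip (idx D K) (w r) (w r)" for r
  have c0: "c r \<ge> 0" for r
    by (simp add: c_def ip_self_nonneg)
  have V': "V r = (\<lambda>y. (1 / sqrt (c r)) * w r y)" for r
    by (simp add: V c_def w_def fun_eq_iff)
  \<comment> \<open>The quotient of \<open>c s\<close> by its root is again the root even for
    \<open>c s = 0\<close>, so degenerate vectors need no separate case here.\<close>
  have Vw: "ip (idx D K) (V s) (w r) = (if r = s then sqrt (c s) else 0)" if "r < R" "s < R" for r s
  proof -
    have "ip (idx D K) (V s) (w r) = (1 / sqrt (c s)) * ip (idx D K) (w s) (w r)"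
      unfolding V' by (rule ip_scale_left)
    then show ?thesis
      using orth[of s r] that real_div_sqrt[OF c0[of s]] by (auto simp: w_def[symmetric] c_def[symmetric])
  qed
  have VV: "ip (idx D K) (V s) (V r) = (if r = s \<and> c r \<noteq> 0 then 1 else 0)" if "r < R" "s < R" for r s
  proof -
    have "ip (idx D K) (V s) (V r) = (1 / sqrt (c r)) * ip (idx D K) (V s) (w r)"
      unfolding V'[of r] by (rule ip_scale_right)
    then show ?thesis
      using that by (simp add: Vw)
  qed
  then show "suborthonormal (idx D K) {..<R} V"
    by (simp add: suborthonormal_def)
  assume i: "i \<in> idx D (J \<union> K)"
  have w_glue: "w r (glue K y i) = w r y" if "y \<in> idx D K" for r y
  proof -
    have "glue J x (glue K y i) = glue J x y" for x
      using i that by (auto simp: glue_def idx_def PiE_def extensional_def fun_eq_iff)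
    then show ?thesis
      by (simp add: w_def block_coeff_def)
  qed
  have w_restrict: "w r (restrict i K) = w r i" for r
  proof -
    have "glue J x (restrict i K) = glue J x i" for x
      using i by (auto simp: glue_def idx_def PiE_def extensional_def fun_eq_iff)
    then show ?thesis
      by (simp add: w_def block_coeff_def)
  qed
  have "block_coeff D K V (contract D R J U \<Phi> A) s i = \<Phi> s i * sqrt (c s)" if "s < R" for s
  proof -
    have "block_coeff D K V (contract D R J U \<Phi> A) s i = ip (idx D K) (V s) (\<lambda>y. \<Sum>r<R. \<Phi> r i * w r y)"
      unfolding block_coeff_def[of D K]
      by (rule ip_cong) (simp_all add: contract_def local w_def[symmetric] w_glue)
    also have "\<dots> = (\<Sum>r<R. \<Phi> r i * (if r = s then sqrt (c s) else 0))"
      using that by (simp add: ip_bilinear Vw)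
    finally show ?thesis
      using that by (simp add: if_distrib cong: if_cong)
  qed
  then have "block_proj D R K V (contract D R J U \<Phi> A) i
      = (\<Sum>s<R. V s (restrict i K) * (\<Phi> s i * sqrt (c s)))"
    by (simp add: block_proj_def contract_def[of D R K])
  also have "\<dots> = (\<Sum>s<R. \<Phi> s i * w s i)"
  proof (rule sum.cong[OF refl])
    fix s
    show "V s (restrict i K) * (\<Phi> s i * sqrt (c s)) = \<Phi> s i * w s i"
    proof (cases "c s = 0")
      \<comment> \<open>\<open>V s\<close> is zero here; the right side vanishes too, since
        \<open>w s\<close> has norm zero on the finite set \<open>idx D K\<close>.\<close>
      case True
      have "restrict i K \<in> idx D K"
        using i by (auto simp: idx_def)
      then have "w s i = 0"
        using True ip_self_eq_0[of "idx D K" "w s"] finite_idx[OF fin, of D]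
        by (simp add: c_def w_restrict[symmetric])
      then show ?thesis
        using True by simp
    qed (simp add: V' w_restrict)
  qed
  finally show "block_proj D R K V (contract D R J U \<Phi> A) i = contract D R J U \<Phi> A i"
    by (simp add: contract_def w_def)
qed

lemma sqnorm_cong: "(\<And>i. i \<in> idx D S \<Longrightarrow> f i = g i) \<Longrightarrow> sqnorm D S f = sqnorm D S g"
  by (simp add: sqnorm_def)

lemma error_bounded_self:
  assumes "error_bounded D S A c F"
  shows "sqnorm D S (\<lambda>i. A i - F A i) \<le> c"
proof -
  have "sqnorm D S (\<lambda>i. A i - F A i) \<le> c + sqnorm D S (\<lambda>i. A i - A i)"
    using assms unfolding error_bounded_def by blast
  then show ?thesis
    by (simp add: sqnorm_def)
qed

text \<open>The node \<open>(l, 2)\<close> needs no residual bound: its vectors span the row space left by \<open>(l, 1)\<close>.\<close>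

lemma binary_root_error:
  assumes good: "\<And>l' n'. l' < l \<Longrightarrow> n' \<in> {1..2^(Suc l - l')} \<Longrightarrow> good_node D 1 R U A (Suc l) \<delta> l' n'"
    and good1: "good_node D 1 R U A (Suc l) \<delta> l 1"
    and orth: "\<And>r s. r < R \<Longrightarrow> s < R \<Longrightarrow> r \<noteq> s \<Longrightarrow>
      ip (idx D (blk 1 l 2)) (block_coeff D (blk 1 l 1) (U l 1) A r) (block_coeff D (blk 1 l 1) (U l 1) A s) = 0"
    and U2: "\<And>r y. U l 2 r y = (1 / sqrt (ip (idx D (blk 1 l 2)) (block_coeff D (blk 1 l 1) (U l 1) A r)
        (block_coeff D (blk 1 l 1) (U l 1) A r))) * block_coeff D (blk 1 l 1) (U l 1) A r y"
  shows "sqnorm D {1..2^Suc l} (\<lambda>i. A i - net D 1 R U (Suc l) 1 A i) \<le> real (2 * num_below 1 l + 1) * \<delta>"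
proof -
  let ?S = "{1..2^(1 * Suc l)} :: nat set"
  let ?\<phi> = "tn_phi (net_leaf U) (net_core D 1 U) 1 R l"
  define B where "B = contract D R (blk 1 l 1) (U l 1) (?\<phi> 1) A"
  have child: "child (Suc 0) (Suc 0) 0 = Suc 0" "child (Suc 0) (Suc 0) (Suc 0) = 2"
    by (simp_all add: child_def)
  have disj: "blk 1 l 1 \<inter> blk 1 l 2 = {}"
    by (rule blk_disjoint) auto
  have local: "?\<phi> 1 r (glue (blk 1 l 2) x i) = ?\<phi> 1 r i" for r x i
    by (rule net_phi_glue) auto
  have "net D 1 R U (Suc l) 1 A = multi_contract D R (Suc 1) (\<lambda>k. blk 1 l (child 1 1 k))
      (\<lambda>k. U l (child 1 1 k)) (\<lambda>k. ?\<phi> (child 1 1 k)) A"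
    by (simp add: numeral_2_eq_2)
  also have "\<dots> = contract D R (blk 1 l 2) (U l 2) (?\<phi> 2)
      (multi_contract D R (Suc 0) (\<lambda>k. blk 1 l (child 1 1 k)) (\<lambda>k. U l (child 1 1 k)) (\<lambda>k. ?\<phi> (child 1 1 k)) A)"
    using multi_contract_Suc[of 1 "\<lambda>k. blk 1 l (child 1 1 k)" "\<lambda>k. ?\<phi> (child 1 1 k)" D R "\<lambda>k. U l (child 1 1 k)" A]
      disj local by (simp add: child)
  also have "\<dots> = contract D R (blk 1 l 2) (U l 2) (?\<phi> 2) B"
    using multi_contract_Suc[of 0 "\<lambda>k. blk 1 l (child 1 1 k)" "\<lambda>k. ?\<phi> (child 1 1 k)" D R "\<lambda>k. U l (child 1 1 k)" A]
    by (simp add: child B_def multi_contract_0)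
  also have "\<dots> = net D 1 R U l 2 (block_proj D R (blk 1 l 2) (U l 2) B)"
    by (rule contract_net_phi) simp
  finally have net: "net D 1 R U (Suc l) 1 A = net D 1 R U l 2 (block_proj D R (blk 1 l 2) (U l 2) B)" .
  have union: "blk 1 l 1 \<union> blk 1 l 2 = ?S"
    by (auto simp: blk_def)
  have bound: "error_bounded D ?S A (real (num_below 1 l) * \<delta>) (net D 1 R U l n)" if "n \<in> {1..2}" for n
    using good that by (intro error_bounded_net) auto
  have "sqnorm D ?S (\<lambda>i. A i - net D 1 R U (Suc l) 1 A i)
      \<le> real (num_below 1 l) * \<delta> + sqnorm D ?S (\<lambda>i. A i - block_proj D R (blk 1 l 2) (U l 2) B i)"
    using bound[of 2] unfolding net by (simp add: error_bounded_def)
  \<comment> \<open>\<open>B\<close> is a combination of the \<open>w s\<close> along the second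
    block and is fixed by this projection. This saves one \<open>\<delta>\<close> compared with
    counting both children of the root.\<close>
  also have "sqnorm D ?S (\<lambda>i. A i - block_proj D R (blk 1 l 2) (U l 2) B i) = sqnorm D ?S (\<lambda>i. A i - B i)"
  proof (rule sqnorm_cong)
    fix i assume "i \<in> idx D ?S"
    then have "i \<in> idx D (blk 1 l 1 \<union> blk 1 l 2)"
      by (simp only: union)
    then have "block_proj D R (blk 1 l 2) (U l 2) B i = B i"
      unfolding B_def
      by (intro row_space_block_proj(2)[OF _ disj orth local U2]) (simp_all add: blk_def)
    then show "A i - block_proj D R (blk 1 l 2) (U l 2) B i = A i - B i"
      by simp
  qed
  also have "sqnorm D ?S (\<lambda>i. A i - B i) \<le> real (num_below 1 l) * \<delta> + \<delta>"
    unfolding B_def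
  proof (rule error_bounded_self)
    show "error_bounded D ?S A (real (num_below 1 l) * \<delta> + \<delta>) (contract D R (blk 1 l 1) (U l 1) (?\<phi> 1))"
      by (rule error_bounded_contract_net_phi[OF _ _ good1 bound]) auto
  qed
  finally show ?thesis
    by (simp add: algebra_simps)
qed

section \<open>Low-rank approximation of a matricization\<close>

text \<open>Rows and columns of \<open>matricize\<close> as multi-indices; \<open>glue\<close> of both is its argument of \<open>A\<close>.\<close>

definition decode :: "(nat \<Rightarrow> nat) \<Rightarrow> nat set \<Rightarrow> nat \<Rightarrow> nat \<Rightarrow> nat" where
  "decode D J k = (\<lambda>n. if n \<in> J then dec D J k n else undefined)"

text \<open>Axes are added in increasing order: the place value of the largest axis is the product
  of all smaller dimensions, so its digit is the next quotient.\<close>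

lemma dec_eq_imp_mod_eq:
  assumes "finite J" "\<And>n. n \<in> J \<Longrightarrow> dec D J k n = dec D J k' n"
  shows "k mod (\<Prod>n\<in>J. D n) = k' mod (\<Prod>n\<in>J. D n)"
  using assms
proof (induction J rule: finite_linorder_max_induct)
  case empty
  then show ?case by simp
next
  case (insert m J)
  have m: "m \<notin> J"
    using insert.hyps by auto
  have "{p \<in> insert m J. p < n} = {p \<in> J. p < n}" if "n \<in> J" for n
    using insert.hyps that by auto
  then have "dec D (insert m J) k n = dec D J k n" if "n \<in> J" for n k
    using that by (simp add: dec_def)
  then have IH: "k mod (\<Prod>n\<in>J. D n) = k' mod (\<Prod>n\<in>J. D n)"
    using insert by (metis insertCI)
  have "{p \<in> insert m J. p < m} = J"
    using insert.hyps by auto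
  then have "dec D (insert m J) k m = k div (\<Prod>n\<in>J. D n) mod D m" for k
    by (simp add: dec_def)
  then have "k div (\<Prod>n\<in>J. D n) mod D m = k' div (\<Prod>n\<in>J. D n) mod D m"
    using insert.prems[of m] by simp
  then have "k mod ((\<Prod>n\<in>J. D n) * D m) = k' mod ((\<Prod>n\<in>J. D n) * D m)"
    using IH by (simp add: mod_mult2_eq)
  then show ?case
    using m insert.hyps by (simp add: mult.commute)
qed

text \<open>The digits determine the number; surjectivity then follows by counting.\<close>

lemma bij_betw_decode:
  assumes J: "finite J" and D: "\<And>n. n \<in> J \<Longrightarrow> D n > 0"
  shows "bij_betw (decode D J) {..<(\<Prod>n\<in>J. D n)} (idx D J)"
proof -
  have inj: "inj_on (decode D J) {..<(\<Prod>n\<in>J. D n)}"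
  proof (rule inj_onI)
    fix k k' assume k: "k \<in> {..<(\<Prod>n\<in>J. D n)}" "k' \<in> {..<(\<Prod>n\<in>J. D n)}" and eq: "decode D J k = decode D J k'"
    have "dec D J k n = dec D J k' n" if "n \<in> J" for n
      using fun_cong[OF eq, of n] that by (simp add: decode_def)
    then have "k mod (\<Prod>n\<in>J. D n) = k' mod (\<Prod>n\<in>J. D n)"
      by (rule dec_eq_imp_mod_eq[OF J])
    then show "k = k'"
      using k by simp
  qed
  have sub: "decode D J ` {..<(\<Prod>n\<in>J. D n)} \<subseteq> idx D J"
    using D by (auto simp: decode_def idx_def dec_def)
  have "card (idx D J) = (\<Prod>n\<in>J. D n)"
    using J by (simp add: idx_def card_PiE)
  then have "decode D J ` {..<(\<Prod>n\<in>J. D n)} = idx D J"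
    using card_subset_eq[OF finite_idx[OF J] sub] card_image[OF inj] by simp
  then show ?thesis
    using inj by (simp add: bij_betw_def)
qed

text \<open>The matrix result is carried over along the decoding bijections of rows and columns,
  which preserve inner products; \<open>enc\<close> turns a row multi-index back into its
  number.\<close>

lemma low_rank_tensor:
  fixes A :: "(nat \<Rightarrow> nat) \<Rightarrow> real"
  assumes J: "J \<subseteq> {1..M}" and D: "\<And>n. n \<in> {1..M} \<Longrightarrow> D n > 0" and R: "R > 0" and b: "b \<ge> 0"
    and Q: "QE D M A J \<le> b * ln (real R)"
  shows "\<exists>U. suborthonormal (idx D J) {..<R} U \<and>
    (\<forall>r<R. \<forall>s<R. r \<noteq> s \<longrightarrow>
      ip (idx D ({1..M} - J)) (block_coeff D J U A r) (block_coeff D J U A s) = 0) \<and>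
    residual D R {1..M} A J U \<le> b * sqnorm D {1..M} A"
proof -
  let ?K = "{1..M} - J"
  define m where "m = (\<Prod>n\<in>J. D n)"
  define n where "n = (\<Prod>n\<in>?K. D n)"
  define X where "X = matricize D M A J"
  have fJ: "finite J"
    using J finite_subset by blast
  have X: "X \<in> carrier_mat m n"
    by (simp add: X_def matricize_def m_def n_def)
  have X_eq: "X $$ (x,y) = A (glue J (decode D J x) (decode D ?K y))" if "x < m" "y < n" for x y
  proof -
    have "(\<lambda>i. if i \<in> J then dec D J x i else if i \<in> {1..M} then dec D ?K y i else undefined)
        = glue J (decode D J x) (decode D ?K y)"
      by (auto simp: glue_def decode_def fun_eq_iff)
    then show ?thesis
      using that by (simp add: X_def matricize_def m_def n_def)
  qed
  have bJ: "bij_betw (decode D J) {..<m} (idx D J)"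
    unfolding m_def using J D fJ by (intro bij_betw_decode) auto
  have bK: "bij_betw (decode D ?K) {..<n} (idx D ?K)"
    unfolding n_def using D by (intro bij_betw_decode) auto
  define enc where "enc = the_inv_into {..<m} (decode D J)"
  have enc: "enc (decode D J x) = x" if "x < m" for x
    unfolding enc_def using bJ that by (intro the_inv_into_f_f) (auto simp: bij_betw_def)
  have H: "mat_entropy X \<le> b * ln (real R)"
    using Q by (simp add: QE_mat_entropy X_def)
  obtain u where so: "suborthonormal {..<m} {..<R} u"
    and orth: "\<forall>r<R. \<forall>s<R. r \<noteq> s \<longrightarrow> ip {..<n} (\<lambda>y. ip {..<m} (u r) (\<lambda>x. X $$ (x,y)))
        (\<lambda>y. ip {..<m} (u s) (\<lambda>x. X $$ (x,y))) = 0"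
    and res: "(\<Sum>x<m. \<Sum>y<n. (X $$ (x,y))\<^sup>2) - (\<Sum>r<R. ip {..<n} (\<lambda>y. ip {..<m} (u r) (\<lambda>x. X $$ (x,y)))
        (\<lambda>y. ip {..<m} (u r) (\<lambda>x. X $$ (x,y)))) \<le> b * (\<Sum>x<m. \<Sum>y<n. (X $$ (x,y))\<^sup>2)"
    using low_rank_matrix[OF X R b H] by blast
  define U where "U r x = u r (enc x)" for r x
  have ipJ: "ip (idx D J) f g = ip {..<m} (\<lambda>x. f (decode D J x)) (\<lambda>x. g (decode D J x))" for f g
    unfolding ip_def by (rule sum.reindex_bij_betw[OF bJ, symmetric])
  have ipK: "ip (idx D ?K) f g = ip {..<n} (\<lambda>x. f (decode D ?K x)) (\<lambda>x. g (decode D ?K x))" for f g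
    unfolding ip_def by (rule sum.reindex_bij_betw[OF bK, symmetric])
  have "ip (idx D J) (U r) (U s) = ip {..<m} (u r) (u s)" for r s
    unfolding ipJ by (rule ip_cong) (simp_all add: U_def enc)
  then have soU: "suborthonormal (idx D J) {..<R} U"
    using so by (simp add: suborthonormal_def)
  have "block_coeff D J U A r (decode D ?K y) = ip {..<m} (u r) (\<lambda>x. X $$ (x,y))" if "y < n" for r y
    unfolding block_coeff_def ipJ using that by (intro ip_cong) (simp_all add: U_def enc X_eq)
  then have ipw: "ip (idx D ?K) (block_coeff D J U A r) (block_coeff D J U A s)
      = ip {..<n} (\<lambda>y. ip {..<m} (u r) (\<lambda>x. X $$ (x,y))) (\<lambda>y. ip {..<m} (u s) (\<lambda>x. X $$ (x,y)))" for r s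
    unfolding ipK by (intro ip_cong) simp_all
  have "sqnorm D {1..M} A = (\<Sum>y<n. \<Sum>x<m. (A (glue J (decode D J x) (decode D ?K y)))\<^sup>2)"
    unfolding sqnorm_def sum_idx_glue[OF J] sum.reindex_bij_betw[OF bJ, symmetric]
      sum.reindex_bij_betw[OF bK, symmetric] ..
  also have "\<dots> = (\<Sum>y<n. \<Sum>x<m. (X $$ (x,y))\<^sup>2)"
    by (intro sum.cong refl) (simp add: X_eq)
  also have "\<dots> = (\<Sum>x<m. \<Sum>y<n. (X $$ (x,y))\<^sup>2)"
    by (rule sum.swap)
  finally have sq: "sqnorm D {1..M} A = (\<Sum>x<m. \<Sum>y<n. (X $$ (x,y))\<^sup>2)" .
  have "residual D R {1..M} A J U \<le> b * sqnorm D {1..M} A"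
    unfolding residual_def sq ipw by (rule res)
  moreover have "\<forall>r<R. \<forall>s<R. r \<noteq> s \<longrightarrow>
      ip (idx D ?K) (block_coeff D J U A r) (block_coeff D J U A s) = 0"
    unfolding ipw by (rule orth)
  ultimately show ?thesis
    using soU by blast
qed

section \<open>Compatible bijections\<close>

text \<open>Used to read off the side of a cube from the number of leaves in its image.\<close>

lemma card_cube: "card (cube P a s) = s ^ P"
proof -
  have "bij_betw (\<lambda>xs. map (\<lambda>p. xs ! p - a p) [0..<P]) (cube P a s) {ys. set ys \<subseteq> {1..s} \<and> length ys = P}"
  proof (rule bij_betw_byWitness[where f' = "\<lambda>ys. map (\<lambda>p. ys ! p + a p) [0..<P]"])
    show "\<forall>xs\<in>cube P a s. map (\<lambda>p. map (\<lambda>p. xs ! p - a p) [0..<P] ! p + a p) [0..<P] = xs"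
      by (auto simp: cube_def list_eq_iff_nth_eq)
    show "\<forall>ys\<in>{ys. set ys \<subseteq> {1..s} \<and> length ys = P}.
        map (\<lambda>p. map (\<lambda>p. ys ! p + a p) [0..<P] ! p - a p) [0..<P] = ys"
      by (auto simp: list_eq_iff_nth_eq)
    show "(\<lambda>xs. map (\<lambda>p. xs ! p - a p) [0..<P]) ` cube P a s \<subseteq> {ys. set ys \<subseteq> {1..s} \<and> length ys = P}"
      by (fastforce simp: cube_def)
    show "(\<lambda>ys. map (\<lambda>p. ys ! p + a p) [0..<P]) ` {ys. set ys \<subseteq> {1..s} \<and> length ys = P} \<subseteq> cube P a s"
    proof (clarsimp simp: cube_def)
      fix ys :: "nat list" and p
      assume "set ys \<subseteq> {Suc 0..s}" "p < length ys"
      then have "ys ! p \<in> {Suc 0..s}"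
        by (meson nth_mem subsetD)
      then show "0 < ys ! p \<and> ys ! p \<le> s"
        by simp
    qed
  qed
  then have "card (cube P a s) = card {ys. set ys \<subseteq> {1..s} \<and> length ys = P}"
    by (rule bij_betw_same_card)
  then show ?thesis
    by (simp add: card_lists_length_eq)
qed

lemma dvd_if_div_eq_ceiling:
  fixes a s :: nat
  assumes "s > 0" "a div s = (a + s - 1) div s"
  shows "s dvd a"
proof (rule ccontr)
  assume "\<not> s dvd a"
  then have "a mod s > 0"
    by (simp add: dvd_eq_mod_eq_0)
  then have "s * (a div s) + s \<le> a + s - 1"
    using mult_div_mod_eq[of s a] by linarith
  then have "a div s + 1 \<le> (a + s - 1) div s"
    using assms(1) by (simp add: less_eq_div_iff_mult_less_eq algebra_simps)
  then show False
    using assms(2) by simp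
qed

text \<open>Cubes of side \<open>s\<close> tiling a grid of side \<open>k * s\<close> sit at multiples of \<open>s\<close>: rounding the
  corners down and up to multiples of \<open>s\<close> gives two bijections from the cubes onto the same lattice,
  so the coordinate sums of both roundings agree.\<close>
lemma tiling_cubes_aligned:
  assumes s: "s > 0" and I: "finite I" "card I = k ^ P"
    and sub: "\<And>n. n \<in> I \<Longrightarrow> cube P (a n) s \<subseteq> grid P (k * s)"
    and disj: "\<And>n n' x. n \<in> I \<Longrightarrow> n' \<in> I \<Longrightarrow> x \<in> cube P (a n) s \<Longrightarrow> x \<in> cube P (a n') s \<Longrightarrow> n = n'"
    and n: "n \<in> I" and p: "p < P"
  shows "s dvd a n p" and "a n p div s < k"
proof -
  define W where "W = {xs. set xs \<subseteq> {..<k} \<and> length xs = P}"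
  have W: "finite W" "card W = k ^ P"
    by (simp_all add: W_def finite_lists_length_eq card_lists_length_eq)
  define lo where "lo n = map (\<lambda>p. a n p div s) [0..<P]" for n
  define hi where "hi n = map (\<lambda>p. (a n p + s - 1) div s) [0..<P]" for n
  have bound: "a n p + s \<le> k * s" if "n \<in> I" "p < P" for n p
  proof -
    have "map (\<lambda>p. a n p + s) [0..<P] \<in> cube P (a n) s"
      using s by (simp add: cube_def)
    then have "map (\<lambda>p. a n p + s) [0..<P] \<in> grid P (k * s)"
      using sub[OF that(1)] by blast
    then show ?thesis
      using that(2) by (simp add: grid_def)
  qed
  have lo_less: "a n p div s < k" and hi_less: "(a n p + s - 1) div s < k" if "n \<in> I" "p < P" for n p
    using bound[OF that] s by (auto simp: div_less_iff_less_mult)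
  have lo_hi: "a n p div s \<le> (a n p + s - 1) div s" for n p
    using s by (intro div_le_mono) simp
  \<comment> \<open>Each cube contains a point with all coordinates divisible by \<open>s\<close>,
    and one with all coordinates one above a multiple of \<open>s\<close>. These points depend only
    on the respective rounding, so disjointness of the cubes makes both roundings injective;
    counting makes them bijective.\<close>
  have lo_mem: "map (\<lambda>p. s * (lo n ! p + 1)) [0..<P] \<in> cube P (a n) s" for n
  proof -
    have "a n p < s * (a n p div s + 1) \<and> s * (a n p div s + 1) \<le> a n p + s" for p
      using s mult_div_mod_eq[of s "a n p"] mod_less_divisor[of s "a n p"]
      unfolding distrib_left by linarith
    then show ?thesis
      by (simp add: cube_def lo_def)
  qed
  have hi_mem: "map (\<lambda>p. s * (hi n ! p) + 1) [0..<P] \<in> cube P (a n) s" for n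
  proof -
    have "a n p < s * ((a n p + s - 1) div s) + 1 \<and> s * ((a n p + s - 1) div s) + 1 \<le> a n p + s" for p
      using s mult_div_mod_eq[of s "a n p + s - 1"] mod_less_divisor[of s "a n p + s - 1"] by linarith
    then show ?thesis
      by (simp add: cube_def hi_def)
  qed
  have "inj_on lo I"
    by (rule inj_onI) (metis disj lo_mem)
  moreover have "lo ` I \<subseteq> W"
    using lo_less by (auto simp: lo_def W_def)
  ultimately have lo: "bij_betw lo I W"
    using W I by (metis bij_betw_def card_image card_subset_eq)
  have "inj_on hi I"
    by (rule inj_onI) (metis disj hi_mem)
  moreover have "hi ` I \<subseteq> W"
    using hi_less by (auto simp: hi_def W_def)
  ultimately have hi: "bij_betw hi I W"
    using W I by (metis bij_betw_def card_image card_subset_eq)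
  have "(\<Sum>n\<in>I. lo n ! p) = (\<Sum>w\<in>W. w ! p)"
    by (rule sum.reindex_bij_betw[OF lo])
  also have "\<dots> = (\<Sum>n\<in>I. hi n ! p)"
    by (rule sum.reindex_bij_betw[OF hi, symmetric])
  finally have "(\<Sum>n\<in>I. a n p div s) = (\<Sum>n\<in>I. (a n p + s - 1) div s)"
    using p by (simp add: lo_def hi_def)
  \<comment> \<open>Rounding down never exceeds rounding up, so equal sums force equality in every
    term.\<close>
  then have "a n p div s = (a n p + s - 1) div s"
    using lo_hi n I(1) by (rule sum_mono_inv)
  then show "s dvd a n p"
    by (rule dvd_if_div_eq_ceiling[OF s])
  show "a n p div s < k"
    by (rule lo_less[OF n p])
qed

text \<open>Compatibility yields a cube of unspecified side and position for each node. Counting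
  leaves fixes the side as \<open>2^l\<close>, and the cubes of one level tile the grid, so they are
  aligned as the canonical blocks are.\<close>

lemma compatible_blk:
  assumes P: "P > 0" and c: "compatible P L \<mu>" and l: "l \<le> L" and n: "n \<in> {1..2^(P*(L-l))}"
  shows "\<exists>K\<in>canonical_blocks P L. \<mu> ` K = blk P l n"
proof -
  define I where "I = {1..(2::nat)^(P*(L-l))}"
  define k where "k = (2::nat)^(L-l)"
  define s where "s = (2::nat)^l"
  have s0: "s > 0"
    by (simp add: s_def)
  have ks: "k * s = 2^L"
    using l by (simp add: k_def s_def power_add[symmetric])
  have M: "((2::nat)^L)^P = 2^(P*L)"
    by (simp add: power_mult[symmetric] mult.commute)
  have bij: "bij_betw \<mu> (grid P (2^L)) {1..2^(P*L)}"
    using c by (simp add: compatible_def M)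
  have ex: "\<forall>n\<in>I. \<exists>a t. {x\<in>grid P (2^L). \<mu> x \<in> blk P l n} = cube P a t"
    using c l by (simp add: compatible_def blk_def I_def)
  obtain a t where at: "\<And>n. n \<in> I \<Longrightarrow> {x\<in>grid P (2^L). \<mu> x \<in> blk P l n} = cube P (a n) (t n)"
    using ex by metis
  have img: "\<mu> ` cube P (a n) (t n) = blk P l n" if "n \<in> I" for n
  proof -
    have "blk P l n \<subseteq> \<mu> ` grid P (2^L)"
      using blk_subset[OF l, of n] that bij by (auto simp: I_def bij_betw_def)
    then show ?thesis
      unfolding at[OF that, symmetric] by blast
  qed
  have t: "t n = s" if "n \<in> I" for n
  proof -
    have "cube P (a n) (t n) \<subseteq> grid P (2^L)"
      using at[OF that] by blast
    then have "inj_on \<mu> (cube P (a n) (t n))"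
      using bij by (auto simp: bij_betw_def intro: inj_on_subset)
    then have "card (blk P l n) = t n ^ P"
      using card_image img[OF that] card_cube by metis
    moreover have "card (blk P l n) = s ^ P"
    proof -
      obtain m where "n = Suc m"
        using \<open>n \<in> I\<close> by (cases n) (auto simp: I_def)
      then show ?thesis
        by (simp add: blk_def s_def power_mult[symmetric] mult.commute)
    qed
    ultimately show ?thesis
      using P by (metis power_eq_iff_eq_base zero_le)
  qed
  have sub: "cube P (a n) s \<subseteq> grid P (k * s)" if "n \<in> I" for n
    using at[OF that] t[OF that] by (auto simp: ks)
  have disj: "n = n'" if "n \<in> I" "n' \<in> I" "x \<in> cube P (a n) s" "x \<in> cube P (a n') s" for n n' x
  proof -
    have "\<mu> x \<in> blk P l n" "\<mu> x \<in> blk P l n'"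
      using at[OF that(1)] at[OF that(2)] t that by auto
    then show ?thesis
      using blk_disjoint[of n n' P l] that by (auto simp: I_def)
  qed
  have card: "card I = k ^ P"
    by (simp add: I_def k_def power_mult[symmetric] mult.commute)
  have nI: "n \<in> I"
    using n by (simp add: I_def)
  have al: "s dvd a n p" "a n p div s < k" if "p < P" for p
    using tiling_cubes_aligned[of s I k P a n p, OF s0 _ card sub disj nI that] by (auto simp: I_def)
  define q where "q p = a n p div s + 1" for p
  \<comment> \<open>Canonical blocks count levels from the root and the tree counts them from the
    leaves, hence the level \<open>L - l\<close> with side \<open>2^l\<close>.\<close>
  have "cube P (a n) s = {xs. length xs = P \<and>
      (\<forall>p<P. 2^(L-(L-l))*(q p - 1) + 1 \<le> xs ! p \<and> xs ! p \<le> 2^(L-(L-l)) * q p)}"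
    using al(1) l by (auto simp: cube_def q_def s_def[symmetric] Suc_le_eq)
  moreover have "\<forall>p<P. 1 \<le> q p \<and> q p \<le> 2^(L-l)"
    using al(2) by (auto simp: q_def k_def Suc_le_eq)
  ultimately have "cube P (a n) s \<in> canonical_blocks P L"
    unfolding canonical_blocks_def using diff_le_self by blast
  then show ?thesis
    using img[OF nI] t[OF nI] by auto
qed

section \<open>The approximation theorem\<close>

lemma tnorm_sqnorm: "tnorm D M A = sqrt (sqnorm D {1..M} A)"
  by (simp add: tnorm_def sqnorm_def tidx_def idx_def)

theorem theorem4:
  fixes P L R :: nat and D :: "nat \<Rightarrow> nat" and A :: "(nat \<Rightarrow> nat) \<Rightarrow> real"
    and \<epsilon> :: real and \<mu> :: "nat list \<Rightarrow> nat"
  assumes "P > 0" and "L > 0" and "R > 0"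
    and "\<forall>n\<in>{1..(2^L)^P}. D n > 0"
    and "\<epsilon> > 0"
    and "compatible P L \<mu>"
    and "\<forall>K\<in>canonical_blocks P L.
           QE D ((2^L)^P) A (\<mu> ` K)
             \<le> \<epsilon>\<^sup>2 / ((2 * real ((2^L)^P) - 3) * (tnorm D ((2^L)^P) A)\<^sup>2) * ln (real R)"
  shows "\<exists>phi0 a aroot.
           tnorm D ((2^L)^P) (\<lambda>i. tn_W phi0 a aroot P L R i - A i) \<le> \<epsilon>"
proof -
  define M where "M = (2::nat)^(P*L)"
  have M: "((2::nat)^L)^P = M"
    by (simp add: M_def power_mult[symmetric] mult.commute)
  have "2^1 \<le> M"
    unfolding M_def using assms(1,2) by (intro power_increasing) auto
  then have M2: "2 * real M - 3 > 0"
    by simp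
  define sq where "sq = sqnorm D {1..M} A"
  have sq0: "sq \<ge> 0"
    by (simp add: sq_def sqnorm_def sum_nonneg)
  define b where "b = \<epsilon>\<^sup>2 / ((2 * real M - 3) * sq)"
  define \<delta> where "\<delta> = \<epsilon>\<^sup>2 / (2 * real M - 3)"
  have b0: "b \<ge> 0"
    using M2 sq0 by (simp add: b_def)
  have \<delta>0: "\<delta> \<ge> 0"
    using M2 by (simp add: \<delta>_def)
  \<comment> \<open>For \<open>A = 0\<close> the division by zero gives \<open>b = 0\<close>, and
    the inequality still holds.\<close>
  have b_\<delta>: "b * sq \<le> \<delta>"
    using \<delta>0 by (cases "sq = 0") (simp_all add: b_def \<delta>_def)
  have QE: "QE D M A (\<mu> ` K) \<le> b * ln (real R)" if "K \<in> canonical_blocks P L" for K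
    using assms(7) that sq0 unfolding M by (simp add: b_def tnorm_sqnorm sq_def)
  define orth where "orth l n U \<longleftrightarrow> (\<forall>r<R. \<forall>s<R. r \<noteq> s \<longrightarrow>
      ip (idx D ({1..M} - blk P l n)) (block_coeff D (blk P l n) U A r) (block_coeff D (blk P l n) U A s) = 0)"
    for l n U
  define good where "good l n U \<longleftrightarrow> suborthonormal (idx D (blk P l n)) {..<R} U \<and>
      residual D R {1..M} A (blk P l n) U \<le> \<delta>" for l n U
  have "\<exists>U. good l n U \<and> orth l n U" if "l \<le> L" "n \<in> {1..2^(P*(L-l))}" for l n
  proof -
    have J: "blk P l n \<subseteq> {1..M}"
      using blk_subset[OF that] by (simp add: M_def)
    have D: "\<And>n. n \<in> {1..M} \<Longrightarrow> D n > 0"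
      using assms(4) by (simp add: M)
    have "QE D M A (blk P l n) \<le> b * ln (real R)"
      using compatible_blk[OF assms(1,6) that] QE by metis
    from low_rank_tensor[OF J D assms(3) b0 this] b_\<delta> show ?thesis
      unfolding good_def orth_def sq_def by (meson order_trans)
  qed
  then obtain U where U: "\<And>l n. l \<le> L \<Longrightarrow> n \<in> {1..2^(P*(L-l))} \<Longrightarrow> good l n (U l n) \<and> orth l n (U l n)"
    by metis
  have good_node: "good_node D P R V A L \<delta> l n \<longleftrightarrow> good l n (V l n)" for V l n
    by (simp add: good_node_def good_def M_def)
  have "\<exists>V. sqnorm D {1..M} (\<lambda>i. A i - net D P R V L 1 A i) \<le> (2 * real M - 3) * \<delta>"
  proof (cases "P = 1")
    case False
    have "error_bounded D {1..M} A (real (num_below P L) * \<delta>) (net D P R U L 1)"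
      unfolding M_def by (rule error_bounded_net) (simp_all add: good_node U)
    then have "sqnorm D {1..M} (\<lambda>i. A i - net D P R U L 1 A i) \<le> real (num_below P L) * \<delta>"
      by (rule error_bounded_self)
    also have "real (num_below P L) * \<delta> \<le> (2 * real M - 3) * \<delta>"
    proof -
      have "num_below P L + 3 \<le> 2 * M"
        using num_below_bound[of P L] False assms(1,2) by (simp add: M_def)
      then have "real (num_below P L) \<le> 2 * real M - 3"
        by linarith
      then show ?thesis
        using \<delta>0 by (simp add: mult_right_mono)
    qed
    finally show ?thesis by blast
  next
    case True
    obtain l where l: "L = Suc l"
      using assms(2) by (cases L) auto
    define w where "w r = block_coeff D (blk 1 l 1) (U l 1) A r" for r
    \<comment> \<open>The vectors at \<open>(l, 2)\<close> are replaced by the normalised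
      coefficients of \<open>A\<close> with respect to those at \<open>(l, 1)\<close>;
      \<open>orth\<close> makes them orthogonal.\<close>
    define V where "V = U(l := (U l)(2 := (\<lambda>r y. (1 / sqrt (ip (idx D (blk 1 l 2)) (w r) (w r))) * w r y)))"
    have "1 \<in> {1..(2::nat)^(P*(L-l))}"
      by simp
    then have U1: "good l 1 (U l 1)" "orth l 1 (U l 1)"
      using U[of l 1] l by auto
    have compl: "{1..M} - blk 1 l 1 = blk 1 l 2"
      by (auto simp: M_def l True blk_def)
    have "sqnorm D {1..2^Suc l} (\<lambda>i. A i - net D 1 R V (Suc l) 1 A i) \<le> real (2 * num_below 1 l + 1) * \<delta>"
    proof (rule binary_root_error)
      show "good_node D 1 R V A (Suc l) \<delta> l' n'" if "l' < l" "n' \<in> {1..2^(Suc l - l')}" for l' n'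
        using good_node[of V l' n'] U[of l' n'] that by (simp add: True l V_def)
      show "good_node D 1 R V A (Suc l) \<delta> l 1"
        using good_node[of V l 1] U1 by (simp add: True l V_def)
      show "ip (idx D (blk 1 l 2)) (block_coeff D (blk 1 l 1) (V l 1) A r)
          (block_coeff D (blk 1 l 1) (V l 1) A s) = 0" if "r < R" "s < R" "r \<noteq> s" for r s
        using U1(2) that unfolding orth_def True compl by (simp add: V_def)
    qed (simp add: V_def w_def)
    also have "real (2 * num_below 1 l + 1) = 2 * real M - 3"
    proof -
      \<comment> \<open>The count is exact: two subtrees with \<open>2 * 2^l - 2\<close> projections
        each and one truncation at the root give precisely \<open>2 * M - 3\<close>.\<close>
      have "2 * num_below 1 l + 1 + 3 = 2 * M"
        using num_below_1[of l] by (simp add: M_def l True)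
      then show ?thesis by linarith
    qed
    finally show ?thesis
      unfolding True l M_def by auto
  qed
  then obtain V where V: "sqnorm D {1..M} (\<lambda>i. A i - net D P R V L 1 A i) \<le> \<epsilon>\<^sup>2"
    using M2 by (auto simp: \<delta>_def)
  let ?W = "tn_W (net_leaf V) (net_core D P V)
      (\<lambda>ks. ip (idx D {1..2^(P*L)}) A (child_prod P V (L - 1) 1 ks)) P L R"
  have "sqnorm D {1..M} (\<lambda>i. ?W i - A i) = sqnorm D {1..M} (\<lambda>i. A i - net D P R V L 1 A i)"
  proof (unfold sqnorm_def, rule sum.cong[OF refl])
    fix i assume "i \<in> idx D {1..M}"
    then have "?W i = net D P R V L 1 A i"
      unfolding M_def by (rule tn_W_eq_net[OF assms(2)])
    then show "(?W i - A i)\<^sup>2 = (A i - net D P R V L 1 A i)\<^sup>2"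
      by (simp only: power2_commute)
  qed
  then have "tnorm D M (\<lambda>i. ?W i - A i) \<le> \<epsilon>"
    using V assms(5) by (simp add: tnorm_sqnorm real_le_lsqrt)
  then show ?thesis
    unfolding M by blast
qed

end
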